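(* Let $k\ge 2$ be an integer and let $G$ be a connected graph of order $n$ with $n \geq (2k+1)^{20+23(k-1)r_{0.0097}}$. Then $S_k(G)\geq S_k(P_n)$, with equality holding if and only if $G\cong P_n$.
   Context: All graphs are finite, simple and undirected. For a graph $G$ of order $n$ (number of vertices), $\lambda_1(G)\ge\cdots\ge\lambda_n(G)$ are the eigenvalues of its adjacency matrix, and for $1\le k\le n$, $S_k(G)=\sum_{i=1}^k\lambda_i(G)$. For an integer $k\ge 2$ and a real $0<\varepsilon\le 1$, define $r_\varepsilon=\left\lceil\frac{\pi}{\arccos(1-\varepsilon/(k-1))}\right\rceil-1$ (it depends on $k$); $r_{0.0097}$ is this quantity with $\varepsilon=0.0097$. $P_n$ is the path of order $n$. *)

theory Defs
  imports
    Complex_Main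
    "Graph_Theory.Graph_Theory"
    "Jordan_Normal_Form.Char_Poly"
begin

(* A finite simple undirected graph is a pair_graph: a finite vertex set with a symmetric
   irreflexive set of ordered pairs, each edge {u,v} being represented by (u,v) and (v,u). *)

definition adjacency_mat :: "'a pair_pre_digraph \<Rightarrow> 'a list \<Rightarrow> real mat" where
  "adjacency_mat G vs =
     mat (length vs) (length vs) (\<lambda>(i, j). if (vs ! i, vs ! j) \<in> parcs G then 1 else 0)"

definition vertex_list :: "'a pair_pre_digraph \<Rightarrow> 'a list" where
  "vertex_list G = (SOME vs. distinct vs \<and> set vs = pverts G)"

(* The real eigenvalues with multiplicity, in non-increasing order. By the lemmas below the
   choice of vertex_list is immaterial and all n eigenvalues are listed. *)

definition graph_eigenvalues :: "'a pair_pre_digraph \<Rightarrow> real list" where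
  "graph_eigenvalues G =
     rev (sorted_list_of_multiset (proots (char_poly (adjacency_mat G (vertex_list G)))))"

(* Indexed from 1; meaningful for 1 <= i <= card (pverts G). *)
definition graph_eigenvalue :: "'a pair_pre_digraph \<Rightarrow> nat \<Rightarrow> real" where
  "graph_eigenvalue G i = graph_eigenvalues G ! (i - 1)"

definition eigenvalue_sum :: "nat \<Rightarrow> 'a pair_pre_digraph \<Rightarrow> real" where
  "eigenvalue_sum k G = (\<Sum>i = 1..k. graph_eigenvalue G i)"

definition path_graph :: "nat \<Rightarrow> nat pair_pre_digraph" where
  "path_graph n =
     \<lparr> pverts = {..<n}, parcs = {(i, j). i < n \<and> j < n \<and> (j = Suc i \<or> i = Suc j)} \<rparr>"

(* Equivalent to the usual adjacency-preserving bijection of vertices: graph_iso_iff. *)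
definition graph_iso :: "'a pair_pre_digraph \<Rightarrow> 'b pair_pre_digraph \<Rightarrow> bool" where
  "graph_iso G H \<longleftrightarrow> digraph_iso (with_proj G) (with_proj H)"

definition r_eps :: "real \<Rightarrow> nat \<Rightarrow> int" where
  "r_eps \<epsilon> k = \<lceil>pi / arccos (1 - \<epsilon> / (real k - 1))\<rceil> - 1"


lemma graph_iso_iff:
  assumes G: "pair_wf_digraph G" and H: "pair_wf_digraph H"
  shows "graph_iso G H \<longleftrightarrow>
    (\<exists>f. bij_betw f (pverts G) (pverts H) \<and>
         (\<forall>u\<in>pverts G. \<forall>v\<in>pverts G. (u, v) \<in> parcs G \<longleftrightarrow> (f u, f v) \<in> parcs H))"
    (is "?L \<longleftrightarrow> ?R")
proof
  assume ?L
  then obtain h where h: "pre_digraph.digraph_isomorphism (with_proj G) h"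
    and e: "with_proj H = app_iso h (with_proj G)"
    by (auto simp: graph_iso_def digraph_iso_def)
  have V: "pverts H = iso_verts h ` pverts G" and A: "parcs H = iso_arcs h ` parcs G"
    and t: "iso_tail h = fst" and hd: "iso_head h = snd"
    using e by (auto simp: with_proj_def app_iso_def)
  have inj: "inj_on (iso_verts h) (pverts G)"
    and ends: "\<And>a. a \<in> parcs G \<Longrightarrow>
      iso_arcs h a = (iso_verts h (fst a), iso_verts h (snd a))"
    using h t hd by (auto simp: pre_digraph.digraph_isomorphism_def prod_eq_iff)
  have "(u, v) \<in> parcs G \<longleftrightarrow> (iso_verts h u, iso_verts h v) \<in> parcs H"
    if uv: "u \<in> pverts G" "v \<in> pverts G" for u v
  proof
    assume "(u, v) \<in> parcs G"
    then show "(iso_verts h u, iso_verts h v) \<in> parcs H"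
      using ends[of "(u, v)"] A by force
  next
    assume "(iso_verts h u, iso_verts h v) \<in> parcs H"
    then obtain a where a: "a \<in> parcs G" "iso_arcs h a = (iso_verts h u, iso_verts h v)"
      using A by force
    then have "fst a \<in> pverts G" "snd a \<in> pverts G"
      using G by (cases a; auto simp: pair_wf_digraph_def)+
    then have "a = (u, v)"
      using a ends[of a] inj uv by (auto simp: inj_on_def prod_eq_iff)
    then show "(u, v) \<in> parcs G" using a by simp
  qed
  then show ?R using inj V by (auto simp: bij_betw_def)
next
  assume ?R
  then obtain f where f: "bij_betw f (pverts G) (pverts H)"
    and e: "\<And>u v. u \<in> pverts G \<Longrightarrow> v \<in> pverts G \<Longrightarrow>
      (u, v) \<in> parcs G \<longleftrightarrow> (f u, f v) \<in> parcs H"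
    by blast
  let ?h = "\<lparr> iso_verts = f, iso_arcs = map_prod f f, iso_head = snd, iso_tail = fst \<rparr>"
  have sub: "u \<in> pverts G" "v \<in> pverts G" if "(u, v) \<in> parcs G" for u v
    using G that by (auto simp: pair_wf_digraph_def)
  have subH: "u \<in> pverts H" "v \<in> pverts H" if "(u, v) \<in> parcs H" for u v
    using H that by (auto simp: pair_wf_digraph_def)
  have "pre_digraph.digraph_isomorphism (with_proj G) ?h"
    unfolding pre_digraph.digraph_isomorphism_def
  proof (intro conjI)
    show "inj_on (iso_arcs ?h) (arcs (with_proj G))"
      using f sub by (auto simp: bij_betw_def inj_on_def)
  qed (use G f in \<open>auto simp: wf_digraph_wp_iff bij_betw_def\<close>)
  moreover have "parcs H = map_prod f f ` parcs G"
  proof (intro equalityI subsetI)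
    fix x assume x: "x \<in> parcs H"
    have "fst x \<in> f ` pverts G" "snd x \<in> f ` pverts G"
      using f x subH[of "fst x" "snd x"] by (auto simp: bij_betw_def)
    then obtain u v where "x = (f u, f v)" "u \<in> pverts G" "v \<in> pverts G"
      by (auto simp: prod_eq_iff)
    with x e show "x \<in> map_prod f f ` parcs G" by force
  next
    fix x assume "x \<in> map_prod f f ` parcs G"
    then obtain u v where "x = (f u, f v)" "(u, v) \<in> parcs G" by auto
    then show "x \<in> parcs H" using e[of u v] sub by simp
  qed
  then have "with_proj H = app_iso ?h (with_proj G)"
    using f by (auto simp: with_proj_def app_iso_def bij_betw_def)
  ultimately show ?L unfolding graph_iso_def digraph_iso_def by blast
qed

lemma pair_graph_path_graph: "pair_graph (path_graph n)"
proof -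
  have "finite {(i, j). i < n \<and> j < n \<and> (j = Suc i \<or> i = Suc j)}"
    by (rule finite_subset[of _ "{..<n} \<times> {..<n}"]) auto
  then show ?thesis
    by unfold_locales (auto simp: path_graph_def symmetric_def sym_def arcs_ends_conv)
qed

lemma vertex_list:
  assumes "finite (pverts G)"
  shows "distinct (vertex_list G)" "set (vertex_list G) = pverts G"
proof -
  have "\<exists>vs. distinct vs \<and> set vs = pverts G"
    using finite_distinct_list[OF assms] by blast
  from someI_ex[OF this] show "distinct (vertex_list G)" "set (vertex_list G) = pverts G"
    by (simp_all add: vertex_list_def)
qed

lemma char_poly_adjacency_mat_cong:
  assumes vs: "distinct vs" and ws: "distinct ws" and eq: "set vs = set ws"
  shows "char_poly (adjacency_mat G vs) = char_poly (adjacency_mat G ws)"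
proof -
  define n where "n = length vs"
  have n: "length vs = n" "length ws = n"
    using distinct_card[OF vs] distinct_card[OF ws] eq by (simp_all add: n_def)
  define P :: "real mat" where "P = mat n n (\<lambda>(i, j). if vs ! i = ws ! j then 1 else 0)"
  define Q :: "real mat" where "Q = mat n n (\<lambda>(i, j). if ws ! i = vs ! j then 1 else 0)"
  have pick: "\<exists>l<n. \<forall>j<n. xs ! i = ys ! j \<longleftrightarrow> j = l"
    if "distinct ys" "length ys = n" "xs ! i \<in> set ys" for xs ys :: "'a list" and i
    using that by (metis in_set_conv_nth nth_eq_iff_index_eq)
  have sm: "(\<Sum>j = 0..<n. (if j = l then 1 else 0) * f j) = f l" if "l < n"
    for l and f :: "nat \<Rightarrow> real"
    by (subst sum.cong[OF refl, where h = "\<lambda>j. if j = l then f j else 0"]) (use that in auto)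
  have sm': "(\<Sum>j = 0..<n. f j * (if j = l then 1 else 0)) = f l" if "l < n"
    for l and f :: "nat \<Rightarrow> real"
    by (subst sum.cong[OF refl, where h = "\<lambda>j. if j = l then f j else 0"]) (use that in auto)
  have C: "adjacency_mat G vs \<in> carrier_mat n n" "adjacency_mat G ws \<in> carrier_mat n n"
    "P \<in> carrier_mat n n" "Q \<in> carrier_mat n n"
    by (auto simp: adjacency_mat_def P_def Q_def n)
  have PQ: "P * Q = 1\<^sub>m n"
  proof (rule eq_matI)
    fix i j assume ij: "i < dim_row (1\<^sub>m n)" "j < dim_col (1\<^sub>m n)"
    then obtain l where l: "l < n" "\<And>m. m < n \<Longrightarrow> vs ! i = ws ! m \<longleftrightarrow> m = l"
      using pick[of ws vs i] ws n eq nth_mem[of i vs] by auto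
    have "(P * Q) $$ (i, j) = (\<Sum>m = 0..<n. (if m = l then 1 else 0) * Q $$ (m, j))"
      using ij l by (auto simp: P_def Q_def scalar_prod_def intro!: sum.cong)
    also have "\<dots> = Q $$ (l, j)" by (rule sm[OF l(1)])
    also have "\<dots> = 1\<^sub>m n $$ (i, j)"
      using ij l(1) l(2)[of l] nth_eq_iff_index_eq[OF vs, of i j] n by (auto simp: Q_def)
    finally show "(P * Q) $$ (i, j) = 1\<^sub>m n $$ (i, j)" .
  qed (auto simp: P_def Q_def)
  have QP: "Q * P = 1\<^sub>m n" using mat_mult_left_right_inverse[OF C(3,4) PQ] .
  have "adjacency_mat G vs * P = P * adjacency_mat G ws"
  proof (rule eq_matI)
    fix i j assume "i < dim_row (P * adjacency_mat G ws)" "j < dim_col (P * adjacency_mat G ws)"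
    then have ij: "i < n" "j < n" using C by auto
    then obtain l where l: "l < n" "\<And>m. m < n \<Longrightarrow> vs ! i = ws ! m \<longleftrightarrow> m = l"
      using pick[of ws vs i] ws n eq nth_mem[of i vs] by auto
    from ij obtain r where r: "r < n" "\<And>m. m < n \<Longrightarrow> ws ! j = vs ! m \<longleftrightarrow> m = r"
      using pick[of vs ws j] vs n eq nth_mem[of j ws] by auto
    have "(adjacency_mat G vs * P) $$ (i, j)
        = (\<Sum>m = 0..<n. adjacency_mat G vs $$ (i, m) * (if m = r then 1 else 0))"
      using ij r(1) r(2)[unfolded eq_commute[of "ws ! j"]] n
      by (auto simp: P_def adjacency_mat_def scalar_prod_def intro!: sum.cong)
    also have "\<dots> = adjacency_mat G vs $$ (i, r)" by (rule sm'[OF r(1)])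
    also have "\<dots> = adjacency_mat G ws $$ (l, j)"
      using ij l(1) r(1) l(2)[of l] r(2)[of r] n by (auto simp: adjacency_mat_def)
    also have "\<dots> = (\<Sum>m = 0..<n. (if m = l then 1 else 0) * adjacency_mat G ws $$ (m, j))"
      by (rule sm[OF l(1), symmetric])
    also have "\<dots> = (P * adjacency_mat G ws) $$ (i, j)"
      using ij l n by (auto simp: P_def adjacency_mat_def scalar_prod_def intro!: sum.cong)
    finally show "(adjacency_mat G vs * P) $$ (i, j) = (P * adjacency_mat G ws) $$ (i, j)" .
  qed (use C in auto)
  then have "adjacency_mat G vs = P * adjacency_mat G ws * Q"
    using assoc_mult_mat[OF C(1,3,4)] right_mult_one_mat[OF C(1)] PQ by simp
  then have "similar_mat_wit (adjacency_mat G vs) (adjacency_mat G ws) P Q"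
    using C PQ QP by (auto simp: similar_mat_wit_def Let_def)
  then show ?thesis by (intro char_poly_similar) (auto simp: similar_mat_def)
qed

lemma real_symmetric_eigenvalue_real:
  fixes A :: "real mat"
  assumes A: "A \<in> carrier_mat n n"
    and sym: "\<And>i j. i < n \<Longrightarrow> j < n \<Longrightarrow> A $$ (i, j) = A $$ (j, i)"
    and ev: "eigenvalue (map_mat complex_of_real A) z"
  shows "z \<in> \<real>"
proof -
  obtain v where v: "v \<in> carrier_vec n" "v \<noteq> 0\<^sub>v n"
    and e: "map_mat complex_of_real A *\<^sub>v v = z \<cdot>\<^sub>v v"
    using ev A by (auto simp: eigenvalue_def eigenvector_def)
  have comp: "(\<Sum>j = 0..<n. of_real (A $$ (i, j)) * v $ j) = z * v $ i" if "i < n" for i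
    using arg_cong[OF e, of "\<lambda>w. w $ i"] that A v by (simp add: scalar_prod_def)
  define N where "N = (\<Sum>i = 0..<n. (cmod (v $ i))\<^sup>2)"
  define S where "S = (\<Sum>i = 0..<n. \<Sum>j = 0..<n. cnj (v $ i) * of_real (A $$ (i, j)) * v $ j)"
  have "S = (\<Sum>i = 0..<n. cnj (v $ i) * (z * v $ i))"
    unfolding S_def by (auto simp: comp[symmetric] sum_distrib_left mult.assoc intro!: sum.cong)
  also have "\<dots> = z * of_real N"
    by (auto simp: N_def sum_distrib_left complex_norm_square mult_ac simp del: of_real_power intro!: sum.cong)
  finally have S: "S = z * of_real N" .
  have "cnj S = (\<Sum>i = 0..<n. \<Sum>j = 0..<n. cnj (v $ j) * of_real (A $$ (j, i)) * v $ i)"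
    unfolding S_def using sym by (auto simp: mult_ac intro!: sum.cong)
  also have "\<dots> = S" unfolding S_def by (rule sum.swap)
  finally have "S \<in> \<real>" by (simp add: complex_is_Real_iff complex_eq_iff)
  obtain i where "i < n" "v $ i \<noteq> 0" using v by (metis carrier_vecD eq_vecI index_zero_vec)
  then have "N \<noteq> 0"
    unfolding N_def by (subst sum_nonneg_eq_0_iff) auto
  then have "z = S / of_real N" using S by simp
  then show ?thesis using \<open>S \<in> \<real>\<close> by simp
qed

lemma length_graph_eigenvalues:
  assumes "pair_graph G"
  shows "length (graph_eigenvalues G) = card (pverts G)"
proof -
  interpret pair_graph G by fact
  define vs where "vs = vertex_list G"
  define A where "A = adjacency_mat G vs"
  define n where "n = card (pverts G)"
  have "length vs = n"
    using vertex_list[of G] distinct_card[of vs] pair_finite_verts by (simp add: vs_def n_def)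
  then have A: "A \<in> carrier_mat n n" by (auto simp: A_def adjacency_mat_def)
  have sym: "A $$ (i, j) = A $$ (j, i)" if "i < n" "j < n" for i j
    using that pair_sym_arcs \<open>length vs = n\<close>
    by (auto simp: A_def adjacency_mat_def symmetric_def sym_def)
  let ?Ac = "map_mat complex_of_real A"
  have Ac: "?Ac \<in> carrier_mat n n" using A by auto
  obtain zs where zs: "char_poly ?Ac = (\<Prod>z\<leftarrow>zs. [:- z, 1:])" "length zs = n"
    using char_poly_factorized[OF Ac] by auto
  have "z \<in> \<real>" if "z \<in> set zs" for z
  proof -
    have "poly (char_poly ?Ac) z = 0"
      unfolding zs(1) poly_prod_list using that by (auto simp: prod_list_zero_iff)
    then show ?thesis
      using real_symmetric_eigenvalue_real[OF A sym] eigenvalue_root_char_poly[OF Ac] by blast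
  qed
  then have zs_eq: "zs = map complex_of_real (map Re zs)"
    by (auto simp: list_eq_iff_nth_eq of_real_Re)
  interpret h: map_poly_inj_idom_hom "complex_of_real" ..
  have "map_poly complex_of_real (char_poly A) = char_poly ?Ac"
    by (rule of_real_hom.char_poly_hom[OF A, symmetric])
  also have "\<dots> = map_poly complex_of_real (\<Prod>x\<leftarrow>map Re zs. [:- x, 1:])"
    unfolding zs(1) by (subst zs_eq) (simp add: h.hom_prod_list o_def)
  finally have "char_poly A = (\<Prod>x\<leftarrow>map Re zs. [:- x, 1:])" by simp
  moreover have "proots (\<Prod>x\<leftarrow>xs. [:- x, 1:]) = mset xs" for xs :: "real list"
  proof (induction xs)
    case (Cons x xs)
    have "(\<Prod>x\<leftarrow>xs. [:- x, 1:]) \<noteq> 0" by (auto simp: prod_list_zero_iff)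
    then have "proots ([:- x, 1:] * (\<Prod>x\<leftarrow>xs. [:- x, 1:])) = {#x#} + mset xs"
      using Cons by (subst proots_mult) auto
    then show ?case by simp
  qed simp
  ultimately have "size (proots (char_poly A)) = n"
    using zs(2) by (simp only: size_mset length_map)
  then show ?thesis
    unfolding graph_eigenvalues_def A_def[symmetric] vs_def[symmetric] n_def[symmetric]
    by (simp flip: size_mset)
qed

end

theory Submission
  imports Defs "Jordan_Normal_Form.Schur_Decomposition"
begin

text \<open>By Ky Fan's principle, \<open>S\<^sub>k(G)\<close> is at least the sum of the Rayleigh quotients of any \<open>k\<close>
  pairwise orthogonal vectors. Since \<open>S\<^sub>k(P\<^sub>n) < 2k\<close>, it suffices in most cases to exhibit a small
  vertex set carrying a vector of quotient \<open>2 + \<delta>\<close> together with \<open>k - 1\<close> disjoint paths whose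
  quotients fall short of \<open>2\<close> by at most \<open>\<delta>\<close> in total. A vertex of degree at least \<open>4k\<^sup>2\<close> alone
  carries a star of quotient \<open>2k\<close>. Otherwise the order forces a long path, which is cut into blocks;
  a small set meets only few of them. For the small set one can take the star with five leaves, the
  star with four leaves and a pendant edge, a triangle with a pendant edge, or the tree with arms
  \<open>1, 2, 6\<close>. Inspecting a longest path shows that a graph containing none of these is a path, a
  cycle, or a path with one or both end vertices doubled. The last three have explicit eigenvectors
  whose eigenvalue sum exceeds that of the path.\<close>

section \<open>Ky Fan's principle for real symmetric matrices\<close>

text \<open>At large order, the graphs that survive are exactly the connected graphs of spectral
  radius at most 2 (Smith's theorem). On these no vector has quotient above 2, so a bound by 2k
  cannot be reached with small sets and explicit spectra take over. Each small heavy graph adds one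
  vertex to a graph of radius exactly 2: the star with four leaves, the triangle, or the tree with
  arms 1, 2, 5.

  The constants are governed by the length of the path. By the choice of \<open>r_eps\<close>, k - 1
  paths on r vertices lose at most 2 * 0.0097 in total. The star with five leaves has excess 2/9 and
  pays for that; an excess of 0.005 does not, and then the blocks need 2 r + 1 vertices and the path
  must be about twice as long. A path nearly as long as the exponent in the hypothesis exists once
  all degrees are at most 4, because 5 <= 2 k + 1. If the degrees are only known to be below 4 k^2,
  the path obtained is about half as long, which is enough for the short blocks but not for the long
  ones. Therefore degrees are lowered in two stages before the other small graphs are
  excluded.\<close>

lemma symmetric_char_poly_splits:
  fixes A :: "real mat"
  assumes A: "A \<in> carrier_mat n n"
    and sym: "\<And>i j. i < n \<Longrightarrow> j < n \<Longrightarrow> A $$ (i, j) = A $$ (j, i)"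
  obtains es where "char_poly A = (\<Prod>e\<leftarrow>es. [:- e, 1:])" "length es = n"
proof -
  let ?Ac = "map_mat complex_of_real A"
  have Ac: "?Ac \<in> carrier_mat n n" using A by auto
  obtain zs where zs: "char_poly ?Ac = (\<Prod>z\<leftarrow>zs. [:- z, 1:])" "length zs = n"
    using char_poly_factorized[OF Ac] by auto
  have "z \<in> \<real>" if "z \<in> set zs" for z
  proof -
    have "poly (char_poly ?Ac) z = 0"
      unfolding zs(1) poly_prod_list using that by (auto simp: prod_list_zero_iff)
    then show ?thesis
      using real_symmetric_eigenvalue_real[OF A sym] eigenvalue_root_char_poly[OF Ac] by blast
  qed
  then have zs_eq: "zs = map complex_of_real (map Re zs)"
    by (auto simp: list_eq_iff_nth_eq of_real_Re)
  interpret h: map_poly_inj_idom_hom "complex_of_real" ..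
  have "map_poly complex_of_real (char_poly A) = char_poly ?Ac"
    by (rule of_real_hom.char_poly_hom[OF A, symmetric])
  also have "\<dots> = map_poly complex_of_real (\<Prod>x\<leftarrow>map Re zs. [:- x, 1:])"
    unfolding zs(1) by (subst zs_eq) (simp add: h.hom_prod_list o_def)
  finally have "char_poly A = (\<Prod>x\<leftarrow>map Re zs. [:- x, 1:])" by simp
  then show ?thesis using that[of "map Re zs"] zs(2) by simp
qed

text \<open>If every root of the characteristic polynomial were \<mu>, so would be every diagonal
  entry of a Schur form, and the trace, which similarity preserves, would be n * \<mu>. The trace
  alone thus produces a new eigenvalue.\<close>

lemma symmetric_eigenvalue_neq:
  fixes A :: "real mat"
  assumes A: "A \<in> carrier_mat n n"
    and sym: "\<And>i j. i < n \<Longrightarrow> j < n \<Longrightarrow> A $$ (i, j) = A $$ (j, i)"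
    and tr: "(\<Sum>i<n. A $$ (i, i)) \<noteq> real n * \<mu>"
  obtains e where "e \<noteq> \<mu>" "eigenvalue A e"
proof -
  obtain es where es: "char_poly A = (\<Prod>e\<leftarrow>es. [:- e, 1:])" "length es = n"
    using symmetric_char_poly_splits[OF A sym] by blast
  have "\<exists>e\<in>set es. e \<noteq> \<mu>"
  proof (rule ccontr)
    assume "\<not> ?thesis"
    then have es_eq: "es = replicate n \<mu>"
      using es(2) by (auto intro: replicate_eqI)
    obtain B P Q where schur: "schur_decomposition A es = (B, P, Q)"
      by (cases "schur_decomposition A es") auto
    have sw: "similar_mat_wit A B P Q" and d: "diag_mat B = es"
      using schur_decomposition[OF A es(1) schur] by auto
    note S = similar_mat_witD2[OF A sw]
    have "(\<Sum>i<n. A $$ (i, i)) = (\<Sum>i<n. \<Sum>j<n. (P * B) $$ (i, j) * Q $$ (j, i))"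
    proof (rule sum.cong[OF refl])
      fix i assume "i \<in> {..<n}"
      then have "(P * B * Q) $$ (i, i) = (\<Sum>j<n. (P * B) $$ (i, j) * Q $$ (j, i))"
        using S(5,6,7) by (simp add: scalar_prod_def lessThan_atLeast0 del: assoc_mult_mat)
      then show "A $$ (i, i) = (\<Sum>j<n. (P * B) $$ (i, j) * Q $$ (j, i))" using S(3) by simp
    qed
    also have "\<dots> = (\<Sum>j<n. \<Sum>i<n. Q $$ (j, i) * (P * B) $$ (i, j))"
      by (subst sum.swap) (simp add: mult.commute)
    also have "\<dots> = (\<Sum>j<n. (Q * (P * B)) $$ (j, j))"
      using S(5,6,7) by (auto simp: scalar_prod_def lessThan_atLeast0 intro!: sum.cong)
    also have "Q * (P * B) = Q * P * B"
      by (rule assoc_mult_mat[symmetric, OF S(7,6,5)])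
    also have "Q * P * B = B"
      unfolding S(2) by (rule left_mult_one_mat[OF S(5)])
    also have "(\<Sum>j<n. B $$ (j, j)) = sum_list (diag_mat B)"
      using S(5) by (simp add: diag_mat_def sum_list_sum_nth lessThan_atLeast0)
    also have "\<dots> = real n * \<mu>" unfolding d es_eq by (simp add: sum_list_replicate)
    finally show False using tr by simp
  qed
  then obtain e where e: "e \<in> set es" "e \<noteq> \<mu>" by blast
  have "poly (char_poly A) e = 0"
    unfolding es(1) poly_prod_list using e(1) by (auto simp: prod_list_zero_iff)
  then show ?thesis using that e(2) eigenvalue_root_char_poly[OF A] by blast
qed

text \<open>Deflation in place of a restriction to the orthogonal complement: adding the rank-one
  terms (\<mu> - l i) u_i u_i^T turns all known eigenvectors into eigenvectors for \<mu>. An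
  eigenvector of the new symmetric matrix for a different eigenvalue is orthogonal to them; there
  the added terms vanish, so it is an eigenvector of \<open>A\<close> as well.\<close>

lemma symmetric_orthonormal_eigenvectors:
  fixes A :: "real mat"
  assumes A: "A \<in> carrier_mat n n"
    and sym: "\<And>i j. i < n \<Longrightarrow> j < n \<Longrightarrow> A $$ (i, j) = A $$ (j, i)"
    and "m \<le> n"
  shows "\<exists>u l. (\<forall>i<m. \<forall>j<m. (\<Sum>a<n. u i a * u j a) = (if i = j then 1 else 0)) \<and>
    (\<forall>i<m. \<forall>a<n. (\<Sum>b<n. A $$ (a, b) * u i b) = l i * (u i a :: real))"
  using \<open>m \<le> n\<close>
proof (induction m)
  case 0
  show ?case by simp
next
  case (Suc m)
  then have "\<exists>u l. (\<forall>i<m. \<forall>j<m. (\<Sum>a<n. u i a * u j a) = (if i = j then 1 else 0)) \<and>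
    (\<forall>i<m. \<forall>a<n. (\<Sum>b<n. A $$ (a, b) * u i b) = l i * (u i a :: real))" by simp
  then obtain u l where
    o: "\<And>i j. i < m \<Longrightarrow> j < m \<Longrightarrow> (\<Sum>a<n. u i a * u j a) = (if i = j then 1 else 0)"
    and ev: "\<And>i a. i < m \<Longrightarrow> a < n \<Longrightarrow> (\<Sum>b<n. A $$ (a, b) * u i b) = l i * (u i a :: real)"
    by blast
  define t where "t = (\<Sum>a<n. A $$ (a, a)) - (\<Sum>i<m. l i)"
  \<comment> \<open>Solves n * \<mu> = m * \<mu> + t + 1, whereas the trace of \<open>B\<close> will
    be m * \<mu> + t. The summand 1 keeps the two apart.\<close>
  define \<mu> where "\<mu> = (t + 1) / (real n - real m)"
  \<comment> \<open>Moving the known eigenvalues to a common value that the trace forbids to be the only one.\<close>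
  define B where "B = mat n n (\<lambda>(a, b). A $$ (a, b) + (\<Sum>i<m. (\<mu> - l i) * u i a * u i b))"
  have B: "B \<in> carrier_mat n n" by (simp add: B_def)
  have Bsym: "B $$ (a, b) = B $$ (b, a)" if "a < n" "b < n" for a b
    using that sym by (auto simp: B_def mult_ac)
  have "(\<Sum>a<n. \<Sum>i<m. (\<mu> - l i) * u i a * u i a) = (\<Sum>i<m. (\<mu> - l i) * (\<Sum>a<n. u i a * u i a))"
    by (subst sum.swap) (simp add: sum_distrib_left mult.assoc)
  also have "\<dots> = real m * \<mu> - (\<Sum>i<m. l i)" by (simp add: o sum_subtractf)
  finally have "(\<Sum>a<n. B $$ (a, a)) = t + real m * \<mu>"
    by (simp add: B_def sum.distrib t_def)
  moreover have "real n * \<mu> = real m * \<mu> + (t + 1)"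
    using Suc.prems by (simp add: \<mu>_def field_simps)
  ultimately have "(\<Sum>a<n. B $$ (a, a)) \<noteq> real n * \<mu>" by simp
  then obtain e where e: "e \<noteq> \<mu>" "eigenvalue B e"
    using symmetric_eigenvalue_neq[OF B Bsym] by blast
  then obtain v where v: "v \<in> carrier_vec n" "v \<noteq> 0\<^sub>v n" "B *\<^sub>v v = e \<cdot>\<^sub>v v"
    using B by (auto simp: eigenvalue_def eigenvector_def)
  have Bv: "(\<Sum>b<n. B $$ (a, b) * v $ b) = e * v $ a" if "a < n" for a
    using arg_cong[OF v(3), of "\<lambda>w. w $ a"] that v(1) B by (simp add: scalar_prod_def lessThan_atLeast0)
  have Bu: "(\<Sum>b<n. B $$ (a, b) * u i b) = \<mu> * u i a" if "a < n" "i < m" for a i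
  proof -
    have "(\<Sum>b<n. (\<Sum>j<m. (\<mu> - l j) * u j a * u j b) * u i b)
        = (\<Sum>j<m. (\<mu> - l j) * u j a * (\<Sum>b<n. u j b * u i b))"
      by (simp add: sum_distrib_right sum_distrib_left mult.assoc) (rule sum.swap)
    also have "\<dots> = (\<Sum>j<m. if j = i then (\<mu> - l i) * u i a else 0)"
      using that by (intro sum.cong) (auto simp: o)
    also have "\<dots> = (\<mu> - l i) * u i a" using that by simp
    finally show ?thesis using that ev[of i a]
      by (simp add: B_def distrib_right sum.distrib algebra_simps)
  qed
  have uv: "(\<Sum>a<n. u i a * v $ a) = 0" if "i < m" for i
  proof -
    have "e * (\<Sum>a<n. u i a * v $ a) = (\<Sum>a<n. u i a * (e * v $ a))"
      by (simp add: sum_distrib_left mult_ac)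
    also have "\<dots> = (\<Sum>a<n. u i a * (\<Sum>b<n. B $$ (a, b) * v $ b))"
      by (intro sum.cong refl) (simp add: Bv)
    also have "\<dots> = (\<Sum>a<n. \<Sum>b<n. u i a * (B $$ (a, b) * v $ b))"
      by (simp add: sum_distrib_left)
    also have "\<dots> = (\<Sum>b<n. \<Sum>a<n. u i a * (B $$ (a, b) * v $ b))" by (rule sum.swap)
    also have "\<dots> = (\<Sum>b<n. (\<Sum>a<n. B $$ (b, a) * u i a) * v $ b)"
      by (auto simp: sum_distrib_left sum_distrib_right Bsym mult_ac intro!: sum.cong)
    also have "\<dots> = (\<Sum>b<n. \<mu> * u i b * v $ b)"
      using that by (intro sum.cong refl) (simp add: Bu)
    also have "\<dots> = \<mu> * (\<Sum>a<n. u i a * v $ a)" by (simp add: sum_distrib_left mult.assoc)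
    finally show ?thesis using e(1) by simp
  qed
  have Av: "(\<Sum>b<n. A $$ (a, b) * v $ b) = e * v $ a" if "a < n" for a
  proof -
    have "(\<Sum>b<n. (\<Sum>j<m. (\<mu> - l j) * u j a * u j b) * v $ b)
        = (\<Sum>j<m. (\<mu> - l j) * u j a * (\<Sum>b<n. u j b * v $ b))"
      by (simp add: sum_distrib_right sum_distrib_left mult.assoc) (rule sum.swap)
    then have "(\<Sum>b<n. (\<Sum>j<m. (\<mu> - l j) * u j a * u j b) * v $ b) = 0" by (simp add: uv)
    then show ?thesis using Bv[OF that] that by (simp add: B_def distrib_right sum.distrib)
  qed
  define N where "N = (\<Sum>a<n. v $ a * v $ a)"
  obtain a where "a < n" "v $ a \<noteq> 0" using v by (metis carrier_vecD eq_vecI index_zero_vec)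
  then have N: "N > 0"
    unfolding N_def by (intro sum_pos2[of _ a]) (auto simp: zero_less_mult_iff)
  define w where "w a = v $ a / sqrt N" for a
  have ww: "(\<Sum>a<n. w a * w a) = 1"
    using N by (simp add: w_def N_def flip: sum_divide_distrib)
  have uw: "(\<Sum>a<n. u i a * w a) = 0" if "i < m" for i
    using uv[OF that] by (simp add: w_def flip: sum_divide_distrib)
  have Aw: "(\<Sum>b<n. A $$ (a, b) * w b) = e * w a" if "a < n" for a
    using Av[OF that] by (simp add: w_def flip: sum_divide_distrib)
  have wu: "(\<Sum>a<n. w a * u i a) = 0" if "i < m" for i
    using uw[OF that] by (simp add: mult.commute)
  show ?case
    by (rule exI[of _ "u(m := w)"], rule exI[of _ "l(m := e)"])
      (auto simp: less_Suc_eq o ev ww uw Aw wu)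
qed

lemma proots_prod_linear_factors: "proots (\<Prod>x\<leftarrow>xs. [:- x, 1:]) = mset (xs :: real list)"
proof (induction xs)
  case (Cons x xs)
  have "(\<Prod>x\<leftarrow>xs. [:- x, 1:]) \<noteq> 0" by (auto simp: prod_list_zero_iff)
  then have "proots ([:- x, 1:] * (\<Prod>x\<leftarrow>xs. [:- x, 1:])) = {#x#} + mset xs"
    using Cons by (subst proots_mult) auto
  then show ?case by simp
qed simp

text \<open>A full orthonormal eigenbasis settles the multiplicities: it diagonalises
  \<open>A\<close> through \<open>U\<close>, whose inverse is its transpose
  \<open>V\<close>.\<close>

lemma proots_char_poly_eigenbasis:
  fixes A :: "real mat"
  assumes A: "A \<in> carrier_mat n n"
    and o: "\<And>i j. i < n \<Longrightarrow> j < n \<Longrightarrow> (\<Sum>a<n. u i a * u j a) = (if i = j then 1 else 0)"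
    and ev: "\<And>i a. i < n \<Longrightarrow> a < n \<Longrightarrow> (\<Sum>b<n. A $$ (a, b) * u i b) = l i * u i a"
  shows "proots (char_poly A) = mset (map l [0..<n])"
proof -
  define U where "U = mat n n (\<lambda>(a, i). u i a)"
  define V where "V = mat n n (\<lambda>(i, a). u i a)"
  define D where "D = mat n n (\<lambda>(i, j). if i = j then l i else 0)"
  have C: "U \<in> carrier_mat n n" "V \<in> carrier_mat n n" "D \<in> carrier_mat n n"
    by (auto simp: U_def V_def D_def)
  have VU: "V * U = 1\<^sub>m n"
    using o by (intro eq_matI) (auto simp: U_def V_def scalar_prod_def simp flip: lessThan_atLeast0)
  have UV: "U * V = 1\<^sub>m n" using mat_mult_left_right_inverse[OF C(2,1) VU] .
  have "A * U = U * D"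
  proof (rule eq_matI)
    fix a i assume "a < dim_row (U * D)" "i < dim_col (U * D)"
    then have ai: "a < n" "i < n" using C by auto
    have "(U * D) $$ (a, i) = (\<Sum>j<n. u j a * (if j = i then l j else 0))"
      using ai by (auto simp: U_def D_def scalar_prod_def lessThan_atLeast0 intro!: sum.cong)
    also have "\<dots> = (\<Sum>j<n. if j = i then u i a * l i else 0)" by (intro sum.cong) auto
    also have "\<dots> = l i * u i a" using ai by (simp add: mult.commute)
    also have "\<dots> = (A * U) $$ (a, i)"
      using ai A ev[OF ai(2,1)] by (simp add: U_def scalar_prod_def lessThan_atLeast0)
    finally show "(A * U) $$ (a, i) = (U * D) $$ (a, i)" by simp
  qed (use C A in auto)
  then have "A = U * D * V"
    using assoc_mult_mat[OF A C(1,2)] right_mult_one_mat[OF A] UV by simp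
  then have "similar_mat_wit A D U V"
    using C A UV VU by (auto simp: similar_mat_wit_def Let_def)
  then have "char_poly A = char_poly D"
    by (intro char_poly_similar) (auto simp: similar_mat_def)
  also have "\<dots> = (\<Prod>a\<leftarrow>diag_mat D. [:- a, 1:])"
    by (rule char_poly_upper_triangular[OF C(3)]) (auto simp: D_def upper_triangular_def)
  also have "diag_mat D = map l [0..<n]" by (auto simp: diag_mat_def D_def)
  finally show ?thesis by (simp only: proots_prod_linear_factors)
qed

section \<open>Sums of the largest eigenvalues\<close>

definition eigenvalue_list :: "real mat \<Rightarrow> real list" where
  "eigenvalue_list A = rev (sorted_list_of_multiset (proots (char_poly A)))"

lemma sum_list_mset_cong:
  fixes f :: "'b \<Rightarrow> 'c :: comm_monoid_add"
  assumes "mset xs = mset ys"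
  shows "sum_list (map f xs) = sum_list (map f ys)"
proof -
  have "sum_mset (mset (map f xs)) = sum_mset (mset (map f ys))" by (simp only: mset_map assms)
  then show ?thesis by (simp only: sum_mset_sum_list)
qed

text \<open>A linear programme: with weights in [0, 1] of total k, weight 1 on the k largest values
  is optimal. After subtracting the k-th largest value \<theta>, the objective is at most the sum of
  the positive parts of l j - \<theta>. That sum depends only on the multiset, so it can be
  evaluated in sorted order.\<close>

lemma sorted_sum_bound:
  fixes c l :: "nat \<Rightarrow> real" and es :: "real list"
  assumes es: "mset es = mset (map l [0..<n])" "sorted (rev es)"
    and c: "\<And>j. j < n \<Longrightarrow> 0 \<le> c j" "\<And>j. j < n \<Longrightarrow> c j \<le> 1" "(\<Sum>j<n. c j) = real k"
  shows "(\<Sum>j<n. l j * c j) \<le> (\<Sum>i<k. es ! i)"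
proof (cases "k = 0")
  case True
  then have "c j = 0" if "j < n" for j
    using c(3) c(1) sum_nonneg_eq_0_iff[of "{..<n}" c] that by simp
  then show ?thesis using True by simp
next
  case False
  have len: "length es = n" using es(1) by (metis length_map length_upt minus_nat.diff_0 size_mset)
  have "real k \<le> (\<Sum>j<n. 1)" unfolding c(3)[symmetric] by (intro sum_mono) (use c(2) in auto)
  then have kn: "k \<le> n" by simp
  define \<theta> where "\<theta> = es ! (k - 1)"
  have "(\<Sum>j<n. l j * c j) = (\<Sum>j<n. c j * \<theta> + (l j - \<theta>) * c j)"
    by (intro sum.cong) (auto simp: algebra_simps)
  also have "\<dots> = real k * \<theta> + (\<Sum>j<n. (l j - \<theta>) * c j)"
    by (simp add: sum.distrib c(3) flip: sum_distrib_right)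
  also have "(\<Sum>j<n. (l j - \<theta>) * c j) \<le> (\<Sum>j<n. max 0 (l j - \<theta>))"
  proof (rule sum_mono)
    fix j assume "j \<in> {..<n}"
    then have "0 \<le> c j" "c j \<le> 1" using c by auto
    then show "(l j - \<theta>) * c j \<le> max 0 (l j - \<theta>)"
      by (cases "l j \<ge> \<theta>") (auto simp: max_def mult_left_le mult_nonpos_nonneg)
  qed
  also have "(\<Sum>j<n. max 0 (l j - \<theta>)) = sum_list (map (\<lambda>x. max 0 (x - \<theta>)) (map l [0..<n]))"
    by (simp add: lessThan_atLeast0 interv_sum_list_conv_sum_set_nat)
  also have "\<dots> = sum_list (map (\<lambda>x. max 0 (x - \<theta>)) es)"
    by (rule sum_list_mset_cong[OF es(1)[symmetric]])
  also have "\<dots> = (\<Sum>i<n. max 0 (es ! i - \<theta>))"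
    by (simp add: sum_list_sum_nth len lessThan_atLeast0)
  also have "\<dots> = (\<Sum>i<n. if i < k then es ! i - \<theta> else 0)"
  proof (rule sum.cong[OF refl])
    fix i assume i: "i \<in> {..<n}"
    have mono: "es ! b \<le> es ! a" if "a \<le> b" "b < n" for a b
      using es(2) that len by (metis sorted_rev_nth_mono)
    show "max 0 (es ! i - \<theta>) = (if i < k then es ! i - \<theta> else 0)"
      using mono[of i "k - 1"] mono[of "k - 1" i] i kn False by (auto simp: \<theta>_def)
  qed
  also have "\<dots> = (\<Sum>i<k. es ! i - \<theta>)"
    by (rule sum.mono_neutral_cong_right) (use kn in auto)
  also have "real k * \<theta> + \<dots> = (\<Sum>i<k. es ! i)" by (simp add: sum_subtractf)
  finally show ?thesis by simp
qed

text \<open>In an orthonormal eigenbasis \<open>u\<close>, the sum of the Rayleigh quotients is a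
  weighted sum of eigenvalues, where the weight \<open>c j\<close> is the squared length of the
  projection of \<open>u j\<close> onto the span of the given vectors. These weights are at most 1
  and have total k, as \<open>sorted_sum_bound\<close> requires.\<close>

lemma ky_fan:
  fixes A :: "real mat" and f :: "nat \<Rightarrow> nat \<Rightarrow> real" and q :: "nat \<Rightarrow> real"
  assumes A: "A \<in> carrier_mat n n"
    and sym: "\<And>i j. i < n \<Longrightarrow> j < n \<Longrightarrow> A $$ (i, j) = A $$ (j, i)"
    and orth: "\<And>s t. s < k \<Longrightarrow> t < k \<Longrightarrow> s \<noteq> t \<Longrightarrow> (\<Sum>a<n. f s a * f t a) = 0"
    and pos: "\<And>t. t < k \<Longrightarrow> (\<Sum>a<n. f t a * f t a) > 0"
    and q: "\<And>t. t < k \<Longrightarrow>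
      q t * (\<Sum>a<n. f t a * f t a) \<le> (\<Sum>a<n. \<Sum>b<n. A $$ (a, b) * f t a * f t b)"
  shows "(\<Sum>t<k. q t) \<le> (\<Sum>i<k. eigenvalue_list A ! i)"
proof -
  obtain u l where
    o: "\<And>i j. i < n \<Longrightarrow> j < n \<Longrightarrow> (\<Sum>a<n. u i a * u j a) = (if i = j then 1 else 0)"
    and ev: "\<And>i a. i < n \<Longrightarrow> a < n \<Longrightarrow> (\<Sum>b<n. A $$ (a, b) * u i b) = l i * (u i a :: real)"
    using symmetric_orthonormal_eigenvectors[OF A sym order_refl] by blast
  \<comment> \<open>Completeness of the basis: a square matrix with orthonormal columns has
    orthonormal rows.\<close>
  have oT: "(\<Sum>j<n. u j a * u j b) = (if a = b then 1 else 0)" if "a < n" "b < n" for a b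
  proof -
    define U where "U = mat n n (\<lambda>(a, i). u i a)"
    define V where "V = mat n n (\<lambda>(i, a). u i a)"
    have "V * U = 1\<^sub>m n"
      using o by (intro eq_matI) (auto simp: U_def V_def scalar_prod_def simp flip: lessThan_atLeast0)
    then have "U * V = 1\<^sub>m n" by (rule mat_mult_left_right_inverse[rotated 2]) (auto simp: U_def V_def)
    then have "(U * V) $$ (a, b) = (if a = b then 1 else 0)" using that by simp
    then show ?thesis using that by (simp add: U_def V_def scalar_prod_def flip: lessThan_atLeast0)
  qed
  define N where "N t = (\<Sum>a<n. f t a * f t a)" for t
  define g where "g t a = f t a / sqrt (N t)" for t a
  define d where "d t j = (\<Sum>a<n. u j a * g t a)" for t j
  define c where "c j = (\<Sum>t<k. (d t j)\<^sup>2)" for j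
  have gg: "(\<Sum>a<n. g s a * g t a) = (if s = t then 1 else 0)" if "s < k" "t < k" for s t
    using that orth[of s t] pos[of t] by (auto simp: g_def N_def simp flip: sum_divide_distrib)
  have exp: "g t a = (\<Sum>j<n. d t j * u j a)" if "a < n" for t a
  proof -
    have "(\<Sum>j<n. d t j * u j a) = (\<Sum>b<n. g t b * (\<Sum>j<n. u j b * u j a))"
      unfolding d_def sum_distrib_right sum_distrib_left by (subst sum.swap) (simp add: mult_ac)
    also have "\<dots> = (\<Sum>b<n. if b = a then g t a else 0)" using that by (intro sum.cong) (auto simp: oT)
    finally show ?thesis using that by simp
  qed
  have dsum: "(\<Sum>j<n. (d t j)\<^sup>2) = 1" if "t < k" for t
  proof -
    have "1 = (\<Sum>a<n. g t a * (\<Sum>j<n. d t j * u j a))" using gg[OF that that] exp by simp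
    also have "\<dots> = (\<Sum>j<n. d t j * (\<Sum>a<n. u j a * g t a))"
      unfolding sum_distrib_left by (subst sum.swap) (simp add: mult_ac)
    finally show ?thesis by (simp add: power2_eq_square flip: d_def)
  qed
  have quad: "(\<Sum>a<n. \<Sum>b<n. A $$ (a, b) * g t a * g t b) = (\<Sum>j<n. l j * (d t j)\<^sup>2)" for t
  proof -
    have "(\<Sum>b<n. A $$ (a, b) * g t b) = (\<Sum>j<n. d t j * l j * u j a)" if "a < n" for a
    proof -
      have "(\<Sum>b<n. A $$ (a, b) * g t b) = (\<Sum>b<n. \<Sum>j<n. d t j * (A $$ (a, b) * u j b))"
        by (intro sum.cong refl) (simp add: exp sum_distrib_left mult_ac)
      also have "\<dots> = (\<Sum>j<n. d t j * (\<Sum>b<n. A $$ (a, b) * u j b))"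
        unfolding sum_distrib_left by (rule sum.swap)
      finally show ?thesis using that by (simp add: ev mult.assoc)
    qed
    then have "(\<Sum>a<n. \<Sum>b<n. A $$ (a, b) * g t a * g t b)
        = (\<Sum>a<n. g t a * (\<Sum>j<n. d t j * l j * u j a))"
      by (intro sum.cong refl) (simp add: mult_ac flip: sum_distrib_left)
    also have "\<dots> = (\<Sum>j<n. d t j * l j * (\<Sum>a<n. u j a * g t a))"
      unfolding sum_distrib_left by (subst sum.swap) (simp add: mult_ac)
    also have "\<dots> = (\<Sum>j<n. d t j * l j * d t j)" by (simp add: d_def)
    finally show ?thesis by (simp add: power2_eq_square mult_ac)
  qed
  \<comment> \<open>Bessel's inequality: the squared distance of \<open>u j\<close> from its
    projection is 1 - c j.\<close>
  have c1: "c j \<le> 1" if "j < n" for j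
  proof -
    have "0 \<le> (\<Sum>a<n. (u j a - (\<Sum>t<k. d t j * g t a))\<^sup>2)" by (intro sum_nonneg) auto
    also have "\<dots> = (\<Sum>a<n. u j a * u j a) - 2 * (\<Sum>a<n. u j a * (\<Sum>t<k. d t j * g t a))
        + (\<Sum>a<n. (\<Sum>t<k. d t j * g t a) * (\<Sum>s<k. d s j * g s a))"
      by (simp add: power2_eq_square algebra_simps sum.distrib sum_subtractf sum_distrib_left)
    also have "(\<Sum>a<n. u j a * (\<Sum>t<k. d t j * g t a)) = (\<Sum>t<k. d t j * (\<Sum>a<n. u j a * g t a))"
      unfolding sum_distrib_left by (subst sum.swap) (simp add: mult_ac)
    also have "\<dots> = c j" by (simp add: c_def power2_eq_square flip: d_def)
    also have "(\<Sum>a<n. (\<Sum>t<k. d t j * g t a) * (\<Sum>s<k. d s j * g s a))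
        = (\<Sum>t<k. d t j * (\<Sum>s<k. d s j * (\<Sum>a<n. g s a * g t a)))"
    proof -
      have "(\<Sum>a<n. (\<Sum>t<k. d t j * g t a) * (\<Sum>s<k. d s j * g s a))
          = (\<Sum>a<n. \<Sum>t<k. \<Sum>s<k. d t j * (d s j * (g s a * g t a)))"
        by (simp add: sum_product mult_ac)
      also have "\<dots> = (\<Sum>t<k. \<Sum>a<n. \<Sum>s<k. d t j * (d s j * (g s a * g t a)))" by (rule sum.swap)
      also have "\<dots> = (\<Sum>t<k. \<Sum>s<k. \<Sum>a<n. d t j * (d s j * (g s a * g t a)))"
        by (rule sum.cong[OF refl], rule sum.swap)
      finally show ?thesis by (simp add: sum_distrib_left)
    qed
    also have "\<dots> = (\<Sum>t<k. d t j * (\<Sum>s<k. if s = t then d t j else 0))"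
      by (intro sum.cong refl arg_cong2[of _ _ _ _ "(*)"]) (auto simp: gg)
    also have "\<dots> = c j" by (simp add: c_def power2_eq_square)
    finally show ?thesis using o[OF that that] by simp
  qed
  have "(\<Sum>t<k. q t) \<le> (\<Sum>t<k. \<Sum>j<n. l j * (d t j)\<^sup>2)"
  proof (rule sum_mono)
    fix t assume "t \<in> {..<k}"
    then have t: "t < k" and Nt: "N t > 0" using pos by (auto simp: N_def)
    have "q t \<le> (\<Sum>a<n. \<Sum>b<n. A $$ (a, b) * f t a * f t b) / N t"
      using q[OF t] Nt by (simp add: pos_le_divide_eq N_def)
    also have "\<dots> = (\<Sum>a<n. \<Sum>b<n. A $$ (a, b) * g t a * g t b)"
      using Nt by (simp add: g_def sum_divide_distrib)
    finally show "q t \<le> (\<Sum>j<n. l j * (d t j)\<^sup>2)" by (simp add: quad)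
  qed
  also have "\<dots> = (\<Sum>j<n. l j * c j)"
    unfolding c_def sum_distrib_left by (rule sum.swap)
  also have "\<dots> \<le> (\<Sum>i<k. eigenvalue_list A ! i)"
  proof (rule sorted_sum_bound)
    show "mset (eigenvalue_list A) = mset (map l [0..<n])"
      using proots_char_poly_eigenbasis[OF A o ev] by (simp add: eigenvalue_list_def)
    show "sorted (rev (eigenvalue_list A))" by (simp add: eigenvalue_list_def)
    show "(\<Sum>j<n. c j) = real k"
      unfolding c_def by (subst sum.swap) (simp add: dsum)
  qed (use c1 in \<open>auto simp: c_def intro!: sum_nonneg\<close>)
  finally show ?thesis .
qed

section \<open>Graph spectra and the spectrum of a path\<close>

lemma pair_graph_symmetric:
  assumes "pair_graph G" shows "(u, v) \<in> parcs G \<longleftrightarrow> (v, u) \<in> parcs G"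
proof -
  interpret pair_graph G by fact
  show ?thesis using pair_sym_arcs by (auto simp: symmetric_def sym_def)
qed

lemma pair_graph_verts:
  assumes "pair_graph G" "(u, v) \<in> parcs G"
  shows "u \<in> pverts G" "v \<in> pverts G" "u \<noteq> v"
proof -
  interpret pair_graph G by fact
  show "u \<in> pverts G" "v \<in> pverts G" "u \<noteq> v"
    using assms(2) by (auto dest: wellformed' no_loops')
qed

lemma pair_graph_finite:
  assumes "pair_graph G" shows "finite (pverts G)" "finite (parcs G)"
proof -
  interpret pair_graph G by fact
  show "finite (pverts G)" "finite (parcs G)" by (rule pair_finite_verts, rule pair_finite_arcs)
qed

lemma eigenvalue_sum_enumeration:
  assumes "distinct vs" "set vs = pverts G"
  shows "eigenvalue_sum k G = (\<Sum>i<k. eigenvalue_list (adjacency_mat G vs) ! i)"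
proof -
  have "finite (pverts G)" using assms(2) by (metis List.finite_set)
  then have "char_poly (adjacency_mat G (vertex_list G)) = char_poly (adjacency_mat G vs)"
    using vertex_list[of G] assms by (intro char_poly_adjacency_mat_cong) auto
  then show ?thesis
    by (simp add: eigenvalue_sum_def graph_eigenvalue_def graph_eigenvalues_def eigenvalue_list_def
        sum.atLeast1_atMost_eq)
qed

lemma adjacency_mat_symmetric:
  assumes "pair_graph G" "i < length vs" "j < length vs"
  shows "adjacency_mat G vs $$ (i, j) = adjacency_mat G vs $$ (j, i)"
  using assms pair_graph_symmetric[OF assms(1)] by (auto simp: adjacency_mat_def)

text \<open>Cycles and forks are never built as graphs of their own: a relation on the indices below
  \<open>n\<close> is all that a computation with eigenvectors needs. Only the values of
  \<open>T\<close> on these indices matter.\<close>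

definition realizes :: "'a pair_pre_digraph \<Rightarrow> nat \<Rightarrow> (nat \<Rightarrow> nat \<Rightarrow> bool) \<Rightarrow> bool" where
  "realizes G n T \<longleftrightarrow> (\<exists>vs. distinct vs \<and> set vs = pverts G \<and> length vs = n \<and>
     (\<forall>i<n. \<forall>j<n. (vs ! i, vs ! j) \<in> parcs G \<longleftrightarrow> T i j))"

lemma realizes_adjacency:
  assumes "realizes G n T"
  obtains vs where "distinct vs" "set vs = pverts G" "length vs = n"
    "adjacency_mat G vs = mat n n (\<lambda>(i, j). if T i j then 1 else 0)"
proof -
  obtain vs where vs: "distinct vs" "set vs = pverts G" "length vs = n"
    "\<forall>i<n. \<forall>j<n. (vs ! i, vs ! j) \<in> parcs G \<longleftrightarrow> T i j"
    using assms by (auto simp: realizes_def)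
  then have "adjacency_mat G vs = mat n n (\<lambda>(i, j). if T i j then 1 else 0)"
    by (intro eq_matI) (auto simp: adjacency_mat_def)
  then show ?thesis using that vs by blast
qed

lemma realizes_eigenvalue_sum_eq:
  assumes "realizes G n T" "realizes H n T"
  shows "eigenvalue_sum k G = eigenvalue_sum k H"
  using realizes_adjacency[OF assms(1)] realizes_adjacency[OF assms(2)]
  by (metis eigenvalue_sum_enumeration)

lemma realizes_path_graph: "realizes (path_graph n) n (\<lambda>i j. j = Suc i \<or> i = Suc j)"
  unfolding realizes_def by (rule exI[of _ "[0..<n]"]) (auto simp: path_graph_def)

lemma graph_iso_realizes:
  assumes G: "pair_graph G" and H: "pair_graph H" and "graph_iso G H" "realizes H n T"
  shows "realizes G n T"
proof -
  interpret G: pair_graph G by fact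
  interpret H: pair_graph H by fact
  obtain f where f: "bij_betw f (pverts G) (pverts H)"
    "\<forall>u\<in>pverts G. \<forall>v\<in>pverts G. (u, v) \<in> parcs G \<longleftrightarrow> (f u, f v) \<in> parcs H"
    using assms(3) graph_iso_iff[OF G.pair_wf_digraph H.pair_wf_digraph] by auto
  obtain vs where vs: "distinct vs" "set vs = pverts H" "length vs = n"
    "\<forall>i<n. \<forall>j<n. (vs ! i, vs ! j) \<in> parcs H \<longleftrightarrow> T i j"
    using assms(4) by (auto simp: realizes_def)
  let ?g = "inv_into (pverts G) f"
  have g: "bij_betw ?g (pverts H) (pverts G)" using f(1) by (rule bij_betw_inv_into)
  have fg: "f (?g u) = u" "?g u \<in> pverts G" if "u \<in> pverts H" for u
    using that f(1) g by (auto simp: bij_betw_def f_inv_into_f inv_into_into)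
  have "(?g (vs ! i), ?g (vs ! j)) \<in> parcs G \<longleftrightarrow> T i j" if "i < n" "j < n" for i j
    using that vs f(2) fg[of "vs ! i"] fg[of "vs ! j"] nth_mem[of i vs] nth_mem[of j vs] by auto
  then show ?thesis
    unfolding realizes_def using vs g
    by (intro exI[of _ "map ?g vs"]) (auto simp: distinct_map bij_betw_def)
qed

lemma realizes_graph_iso:
  assumes G: "pair_graph G" and H: "pair_graph H" and "realizes G n T" "realizes H n T"
  shows "graph_iso G H"
proof -
  interpret G: pair_graph G by fact
  interpret H: pair_graph H by fact
  obtain vs where vs: "distinct vs" "set vs = pverts G" "length vs = n"
    "\<forall>i<n. \<forall>j<n. (vs ! i, vs ! j) \<in> parcs G \<longleftrightarrow> T i j"
    using assms(3) by (auto simp: realizes_def)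
  obtain ws where ws: "distinct ws" "set ws = pverts H" "length ws = n"
    "\<forall>i<n. \<forall>j<n. (ws ! i, ws ! j) \<in> parcs H \<longleftrightarrow> T i j"
    using assms(4) by (auto simp: realizes_def)
  have bv: "bij_betw ((!) vs) {..<n} (pverts G)" and bw: "bij_betw ((!) ws) {..<n} (pverts H)"
    using vs ws by (auto intro: bij_betw_nth)
  let ?i = "inv_into {..<n} ((!) vs)"
  have i: "?i u < n" "vs ! ?i u = u" if "u \<in> pverts G" for u
    using that bv inv_into_into[of u "(!) vs" "{..<n}"] by (auto simp: bij_betw_def f_inv_into_f)
  have "bij_betw ((!) ws \<circ> ?i) (pverts G) (pverts H)"
    using bij_betw_inv_into[OF bv] bw by (rule bij_betw_trans)
  moreover have "(u, v) \<in> parcs G \<longleftrightarrow> (ws ! ?i u, ws ! ?i v) \<in> parcs H"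
    if "u \<in> pverts G" "v \<in> pverts G" for u v
    using i[OF that(1)] i[OF that(2)] vs(4) ws(4) by metis
  ultimately show ?thesis
    unfolding graph_iso_iff[OF G.pair_wf_digraph H.pair_wf_digraph]
    by (intro exI[of _ "(!) ws \<circ> ?i"]) auto
qed

lemma eigenvectors_orthogonal:
  fixes A :: "real mat"
  assumes sym: "\<And>i j. i < n \<Longrightarrow> j < n \<Longrightarrow> A $$ (i, j) = A $$ (j, i)"
    and f: "\<And>a. a < n \<Longrightarrow> (\<Sum>b<n. A $$ (a, b) * f b) = \<mu> * f a"
    and g: "\<And>a. a < n \<Longrightarrow> (\<Sum>b<n. A $$ (a, b) * g b) = \<nu> * g a"
    and "\<mu> \<noteq> \<nu>"
  shows "(\<Sum>a<n. f a * g a) = 0"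
proof -
  have "\<mu> * (\<Sum>a<n. f a * g a) = (\<Sum>a<n. (\<mu> * f a) * g a)"
    by (simp add: sum_distrib_left mult.assoc)
  also have "\<dots> = (\<Sum>a<n. (\<Sum>b<n. A $$ (a, b) * f b) * g a)" by (simp add: f)
  also have "\<dots> = (\<Sum>b<n. f b * (\<Sum>a<n. A $$ (b, a) * g a))"
    unfolding sum_distrib_right sum_distrib_left
    by (subst sum.swap) (auto simp: sym mult_ac intro!: sum.cong)
  also have "\<dots> = (\<Sum>b<n. f b * (\<nu> * g b))" by (intro sum.cong refl) (simp add: g)
  also have "\<dots> = \<nu> * (\<Sum>a<n. f a * g a)" by (simp add: sum_distrib_left mult_ac)
  finally show ?thesis using \<open>\<mu> \<noteq> \<nu>\<close> by simp
qed

text \<open>For a lower bound it is enough to exhibit k eigenvectors, without knowing the rest of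
  the spectrum or that these eigenvalues are the largest. Eigenvectors for different eigenvalues are
  orthogonal anyway; the cycle is the one application in which eigenvalues coincide.\<close>

lemma eigenvalue_sum_ge_eigenvectors:
  fixes f :: "nat \<Rightarrow> nat \<Rightarrow> real"
  assumes G: "pair_graph G" and T: "realizes G n T"
    and ev: "\<And>t a. t < k \<Longrightarrow> a < n \<Longrightarrow> (\<Sum>b<n. if T a b then f t b else 0) = \<mu> t * f t a"
    and nz: "\<And>t. t < k \<Longrightarrow> \<exists>a<n. f t a \<noteq> 0"
    and orth: "\<And>s t. s < t \<Longrightarrow> t < k \<Longrightarrow> \<mu> s = \<mu> t \<Longrightarrow> (\<Sum>a<n. f s a * f t a) = 0"
  shows "(\<Sum>t<k. \<mu> t) \<le> eigenvalue_sum k G"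
proof -
  obtain vs where vs: "distinct vs" "set vs = pverts G" "length vs = n"
    and A: "adjacency_mat G vs = mat n n (\<lambda>(i, j). if T i j then 1 else 0)"
    using realizes_adjacency[OF T] by blast
  define A where "A = adjacency_mat G vs"
  have C: "A \<in> carrier_mat n n" by (simp add: A A_def)
  have sym: "A $$ (i, j) = A $$ (j, i)" if "i < n" "j < n" for i j
    using adjacency_mat_symmetric[OF G] vs(3) that by (auto simp: A_def)
  have Aev: "(\<Sum>b<n. A $$ (a, b) * f t b) = \<mu> t * f t a" if "t < k" "a < n" for t a
    unfolding ev[OF that, symmetric] using that by (intro sum.cong) (auto simp: A A_def)
  have "(\<Sum>t<k. \<mu> t) \<le> (\<Sum>i<k. eigenvalue_list A ! i)"
  proof (rule ky_fan[OF C sym])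
    fix s t assume st: "s < k" "t < k" "s \<noteq> t"
    show "(\<Sum>a<n. f s a * f t a) = 0"
    proof (cases "\<mu> s = \<mu> t")
      case True
      then show ?thesis using orth[of s t] orth[of t s] st
        by (cases "s < t") (auto simp: mult.commute)
    next
      case False
      then show ?thesis using eigenvectors_orthogonal[OF sym Aev Aev] st by blast
    qed
  next
    fix t assume t: "t < k"
    obtain a where "a < n" "f t a \<noteq> 0" using nz[OF t] by blast
    then show "(\<Sum>a<n. f t a * f t a) > 0"
      by (intro sum_pos2[of _ a]) (auto simp: zero_less_mult_iff)
    have "(\<Sum>a<n. \<Sum>b<n. A $$ (a, b) * f t a * f t b) = (\<Sum>a<n. f t a * (\<Sum>b<n. A $$ (a, b) * f t b))"
      by (simp add: sum_distrib_left mult_ac)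
    also have "\<dots> = (\<Sum>a<n. f t a * (\<mu> t * f t a))"
      using t by (intro sum.cong refl) (simp add: Aev)
    also have "\<dots> = \<mu> t * (\<Sum>a<n. f t a * f t a)" by (simp add: sum_distrib_left mult_ac)
    finally show "\<mu> t * (\<Sum>a<n. f t a * f t a) \<le> (\<Sum>a<n. \<Sum>b<n. A $$ (a, b) * f t a * f t b)" by simp
  qed auto
  then show ?thesis using eigenvalue_sum_enumeration[OF vs(1,2)] by (simp add: A_def)
qed

section \<open>The spectrum of a path\<close>

lemma sum_path_neighbours:
  fixes g :: "nat \<Rightarrow> real"
  assumes "a < n"
  shows "(\<Sum>b<n. if b = Suc a \<or> a = Suc b then g b else 0)
    = (if Suc a < n then g (Suc a) else 0) + (if 0 < a then g (a - 1) else 0)"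
proof -
  have "(\<Sum>b<n. if b = Suc a \<or> a = Suc b then g b else 0)
      = (\<Sum>b<n. (if b = Suc a then g b else 0) + (if b = a - 1 then (if 0 < a then g b else 0) else 0))"
    by (intro sum.cong) auto
  also have "\<dots> = (if Suc a < n then g (Suc a) else 0) + (if 0 < a then g (a - 1) else 0)"
    using assms by (simp add: sum.distrib)
  finally show ?thesis .
qed

lemma sin_three_term: "sin ((x + 1) * \<theta>) + sin ((x - 1) * \<theta>) = 2 * cos \<theta> * sin (x * \<theta> :: real)"
  by (simp add: distrib_right left_diff_distrib sin_add sin_diff)

lemma cos_three_term: "cos ((x + 1) * \<theta>) + cos ((x - 1) * \<theta>) = 2 * cos \<theta> * cos (x * \<theta> :: real)"
  by (simp add: distrib_right left_diff_distrib cos_add cos_diff)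

text \<open>Vertex \<open>b\<close> sits at position b + 1 of a wave that is zero at 0 and, by
  assumption, at n + 1. The missing neighbours of the two ends can therefore be supplied with value
  0, and the three-term identity holds at every vertex.\<close>

lemma path_eigenvector:
  assumes "a < n" and "sin ((real n + 1) * \<theta>) = 0"
  shows "(\<Sum>b<n. if b = Suc a \<or> a = Suc b then sin ((real b + 1) * \<theta>) else 0)
    = 2 * cos \<theta> * sin ((real a + 1) * \<theta>)"
proof -
  have "(if Suc a < n then sin ((real (Suc a) + 1) * \<theta>) else 0) = sin ((real a + 1 + 1) * \<theta>)"
  proof (cases "Suc a < n")
    case False
    then have "real n = real a + 1" using assms(1) by simp
    then show ?thesis using False assms(2) by simp
  qed (simp add: add.commute)
  moreover have "(if 0 < a then sin ((real (a - 1) + 1) * \<theta>) else 0) = sin ((real a + 1 - 1) * \<theta>)"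
    by (simp add: of_nat_diff)
  ultimately show ?thesis
    unfolding sum_path_neighbours[OF assms(1)] using sin_three_term[of "real a + 1" \<theta>] by simp
qed

lemma proots_char_poly_orthogonal_eigenvectors:
  fixes A :: "real mat"
  assumes A: "A \<in> carrier_mat n n"
    and o: "\<And>i j. i < n \<Longrightarrow> j < n \<Longrightarrow> i \<noteq> j \<Longrightarrow> (\<Sum>a<n. f i a * f j a) = 0"
    and pos: "\<And>i. i < n \<Longrightarrow> (\<Sum>a<n. f i a * f i a) > 0"
    and ev: "\<And>i a. i < n \<Longrightarrow> a < n \<Longrightarrow> (\<Sum>b<n. A $$ (a, b) * f i b) = l i * f i a"
  shows "proots (char_poly A) = mset (map l [0..<n])"
proof (rule proots_char_poly_eigenbasis[OF A])
  define N where "N i = (\<Sum>a<n. f i a * f i a)" for i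
  fix i assume i: "i < n"
  fix j assume j: "j < n"
  show "(\<Sum>a<n. f i a / sqrt (N i) * (f j a / sqrt (N j))) = (if i = j then 1 else 0)"
    using pos[OF i] o[OF i j] by (auto simp: N_def simp flip: sum_divide_distrib)
  show "(\<Sum>b<n. A $$ (j, b) * (f i b / sqrt (N i))) = l i * (f i j / sqrt (N i))"
    using ev[OF i j] by (simp flip: sum_divide_distrib)
qed

text \<open>The sum for the path is also needed from above, hence the whole spectrum. As cos
  decreases strictly on [0, pi], the values \<open>l i\<close> are distinct: the eigenvectors are
  automatically orthogonal, and the list is already in non-increasing order.\<close>

lemma eigenvalue_sum_path_graph:
  assumes "k \<le> n"
  shows "eigenvalue_sum k (path_graph n) = (\<Sum>t<k. 2 * cos (real (Suc t) * pi / (real n + 1)))"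
proof -
  define \<theta> where "\<theta> i = real (Suc i) * pi / (real n + 1)" for i
  define f where "f i b = sin ((real b + 1) * \<theta> i)" for i b :: nat
  define l where "l i = 2 * cos (\<theta> i)" for i
  define A where "A = adjacency_mat (path_graph n) [0..<n]"
  have A: "A = mat n n (\<lambda>(i, j). if j = Suc i \<or> i = Suc j then 1 else 0)"
    by (rule eq_matI) (auto simp: A_def adjacency_mat_def path_graph_def)
  have C: "A \<in> carrier_mat n n" by (simp add: A)
  have \<theta>: "0 < \<theta> i" "\<theta> i < pi" if "i < n" for i
  proof -
    show "0 < \<theta> i" unfolding \<theta>_def by (intro divide_pos_pos mult_pos_pos) auto
    show "\<theta> i < pi" using that by (simp add: \<theta>_def field_simps)
  qed
  have l_less: "l j < l i" if "i < j" "j < n" for i j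
  proof -
    have "\<theta> i < \<theta> j" using that by (simp add: \<theta>_def divide_strict_right_mono)
    then show ?thesis using \<theta>[of i] \<theta>[of j] that by (simp add: l_def cos_monotone_0_pi)
  qed
  have ev: "(\<Sum>b<n. A $$ (a, b) * f i b) = l i * f i a" if "i < n" "a < n" for i a
  proof -
    have "(\<Sum>b<n. A $$ (a, b) * f i b) = (\<Sum>b<n. if b = Suc a \<or> a = Suc b then sin ((real b + 1) * \<theta> i) else 0)"
      using that by (intro sum.cong) (auto simp: A f_def)
    also have "\<dots> = l i * f i a"
      unfolding l_def f_def
    proof (rule path_eigenvector[OF \<open>a < n\<close>])
      have "(real n + 1) * \<theta> i = real (Suc i) * pi" by (simp add: \<theta>_def)
      then show "sin ((real n + 1) * \<theta> i) = 0" by (simp only: sin_npi)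
    qed
    finally show ?thesis .
  qed
  have "proots (char_poly A) = mset (map l [0..<n])"
  proof (rule proots_char_poly_orthogonal_eigenvectors[OF C _ _ ev])
    fix i j assume ij: "i < n" "j < n" "i \<noteq> j"
    then have "l i \<noteq> l j" using l_less[of i j] l_less[of j i] by (cases "i < j") auto
    then show "(\<Sum>a<n. f i a * f j a) = 0"
      by (intro eigenvectors_orthogonal[OF _ ev ev]) (use ij in \<open>auto simp: A\<close>)
  next
    fix i assume i: "i < n"
    then have "f i 0 > 0" using \<theta>[of i] by (simp add: f_def sin_gt_zero)
    then show "(\<Sum>a<n. f i a * f i a) > 0"
      using i by (intro sum_pos2[of _ 0]) auto
  qed
  moreover have "l j \<le> l i" if "i \<le> j" "j < n" for i j
    using l_less[of i j] that by (cases "i = j") auto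
  then have "sorted (rev (map l [0..<n]))" by (auto simp: sorted_rev_iff_nth_mono)
  then have "sort (map l [0..<n]) = rev (map l [0..<n])" by (intro properties_for_sort) auto
  ultimately have "eigenvalue_list A = map l [0..<n]"
    by (simp add: eigenvalue_list_def del: mset_map)
  then have "(\<Sum>i<k. eigenvalue_list A ! i) = (\<Sum>t<k. l t)"
    using assms by (intro sum.cong) auto
  moreover have "eigenvalue_sum k (path_graph n) = (\<Sum>i<k. eigenvalue_list A ! i)"
    unfolding A_def by (rule eigenvalue_sum_enumeration) (auto simp: path_graph_def)
  ultimately show ?thesis by (simp add: l_def \<theta>_def)
qed

lemma eigenvalue_sum_path_graph_less:
  assumes "1 \<le> k" "k \<le> n"
  shows "eigenvalue_sum k (path_graph n) < 2 * real k"
proof -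
  have "(\<Sum>t<k. 2 * cos (real (Suc t) * pi / (real n + 1))) < (\<Sum>t<k. 2)"
  proof (rule sum_strict_mono)
    fix t assume "t \<in> {..<k}"
    then have "real (Suc t) * pi / (real n + 1) \<le> pi" using assms by (simp add: field_simps)
    moreover have "0 < real (Suc t) * pi / (real n + 1)"
      by (intro divide_pos_pos mult_pos_pos) auto
    ultimately have "cos (real (Suc t) * pi / (real n + 1)) < cos 0" by (intro cos_monotone_0_pi) auto
    then show "2 * cos (real (Suc t) * pi / (real n + 1)) < 2" by simp
  qed (use assms in \<open>auto simp: lessThan_empty_iff\<close>)
  then show ?thesis using eigenvalue_sum_path_graph[OF assms(2)] by simp
qed

section \<open>Disjoint supports and long paths\<close>

text \<open>The arcs contain both orientations of every edge, so the last sum is the quadratic form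
  of the adjacency matrix and \<open>q\<close> is a lower bound for a Rayleigh quotient.\<close>

definition carries :: "'a pair_pre_digraph \<Rightarrow> 'a set \<Rightarrow> real \<Rightarrow> bool" where
  "carries G S q \<longleftrightarrow> (\<exists>f. (\<forall>u. u \<notin> S \<longrightarrow> f u = 0) \<and> 0 < (\<Sum>u\<in>pverts G. f u * f u) \<and>
     q * (\<Sum>u\<in>pverts G. f u * f u) \<le> (\<Sum>(u, v)\<in>parcs G. f u * f v))"

text \<open>Edges between the supports do no harm: Ky Fan's bound asks only that the vectors be
  orthogonal, and no term mixing two of them enters it.\<close>

lemma eigenvalue_sum_ge_disjoint:
  assumes G: "pair_graph G"
    and S: "\<And>t. t < k \<Longrightarrow> carries G (S t) (q t)"
    and disj: "\<And>s t. s < t \<Longrightarrow> t < k \<Longrightarrow> S s \<inter> S t = {}"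
  shows "(\<Sum>t<k. q t) \<le> eigenvalue_sum k G"
proof -
  have "\<exists>f. \<forall>t. t < k \<longrightarrow> (\<forall>u. u \<notin> S t \<longrightarrow> f t u = 0) \<and> 0 < (\<Sum>u\<in>pverts G. f t u * f t u) \<and>
     q t * (\<Sum>u\<in>pverts G. f t u * f t u) \<le> (\<Sum>(u, v)\<in>parcs G. f t u * f t v)"
    using S unfolding carries_def by (intro choice) blast
  then obtain f where f0: "\<And>t u. t < k \<Longrightarrow> u \<notin> S t \<Longrightarrow> f t u = 0"
    and fpos: "\<And>t. t < k \<Longrightarrow> 0 < (\<Sum>u\<in>pverts G. f t u * f t u)"
    and fq: "\<And>t. t < k \<Longrightarrow>
      q t * (\<Sum>u\<in>pverts G. f t u * f t u) \<le> (\<Sum>(u, v)\<in>parcs G. f t u * f t v)"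
    by blast
  note fin = pair_graph_finite[OF G]
  define vs where "vs = vertex_list G"
  have vs: "distinct vs" "set vs = pverts G"
    using vertex_list[OF fin(1)] by (simp_all add: vs_def)
  define n where "n = length vs"
  have bij: "bij_betw ((!) vs) {..<n} (pverts G)"
    using vs by (intro bij_betw_nth) (auto simp: n_def)
  have reindex: "(\<Sum>a<n. h (vs ! a)) = (\<Sum>u\<in>pverts G. h u)" for h :: "'a \<Rightarrow> real"
    using sum.reindex_bij_betw[OF bij] .
  define A where "A = adjacency_mat G vs"
  have C: "A \<in> carrier_mat n n" by (simp add: A_def adjacency_mat_def n_def)
  have "(\<Sum>t<k. q t) \<le> (\<Sum>i<k. eigenvalue_list A ! i)"
  proof (rule ky_fan[OF C])
    fix i j assume "i < n" "j < n"
    then show "A $$ (i, j) = A $$ (j, i)"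
      using adjacency_mat_symmetric[OF G] by (simp add: A_def n_def)
  next
    fix s t assume st: "s < k" "t < k" "s \<noteq> t"
    then have "S s \<inter> S t = {}" using disj[of s t] disj[of t s] by (cases "s < t") auto
    then show "(\<Sum>a<n. f s (vs ! a) * f t (vs ! a)) = 0"
      using f0[of s] f0[of t] st by (intro sum.neutral) (metis disjoint_iff mult_eq_0_iff)
  next
    fix t assume t: "t < k"
    show "0 < (\<Sum>a<n. f t (vs ! a) * f t (vs ! a))"
      using fpos[OF t] reindex[of "\<lambda>u. f t u * f t u"] by simp
    have "(\<Sum>a<n. \<Sum>b<n. A $$ (a, b) * f t (vs ! a) * f t (vs ! b))
      = (\<Sum>a<n. \<Sum>b<n. if (vs ! a, vs ! b) \<in> parcs G then f t (vs ! a) * f t (vs ! b) else 0)"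
      by (intro sum.cong refl) (auto simp: A_def adjacency_mat_def n_def)
    also have "\<dots> = (\<Sum>a<n. \<Sum>v\<in>pverts G. if (vs ! a, v) \<in> parcs G then f t (vs ! a) * f t v else 0)"
      by (intro sum.cong refl) (rule reindex)
    also have "\<dots> = (\<Sum>u\<in>pverts G. \<Sum>v\<in>pverts G. if (u, v) \<in> parcs G then f t u * f t v else 0)"
      by (rule reindex)
    also have "\<dots> = (\<Sum>e\<in>pverts G \<times> pverts G. if e \<in> parcs G then f t (fst e) * f t (snd e) else 0)"
      by (subst sum.cartesian_product) (auto intro!: sum.cong)
    also have "\<dots> = (\<Sum>e\<in>parcs G. f t (fst e) * f t (snd e))"
      by (rule sum.mono_neutral_cong_right) (use fin pair_graph_verts[OF G] in auto)
    finally show "q t * (\<Sum>a<n. f t (vs ! a) * f t (vs ! a))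
        \<le> (\<Sum>a<n. \<Sum>b<n. A $$ (a, b) * f t (vs ! a) * f t (vs ! b))"
      using fq[OF t] reindex[of "\<lambda>u. f t u * f t u"] by (simp add: case_prod_beta)
  qed
  then show ?thesis using eigenvalue_sum_enumeration[OF vs] by (simp add: A_def)
qed

text \<open>The subgraph need not be induced: as the weights are nonnegative, further edges among
  \<open>hs\<close> can only increase the quadratic form. \<open>E\<close> lists each edge in one
  orientation, whence the factor 2.\<close>

lemma carries_embedding:
  fixes w :: "nat \<Rightarrow> real"
  assumes G: "pair_graph G" and hs: "distinct hs" "set hs \<subseteq> pverts G"
    and w: "\<And>i. i < length hs \<Longrightarrow> 0 \<le> w i" and pos: "0 < (\<Sum>i<length hs. w i * w i)"
    and E: "\<And>i j. (i, j) \<in> E \<Longrightarrow> i < j \<and> j < length hs \<and> (hs ! i, hs ! j) \<in> parcs G"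
    and q: "q * (\<Sum>i<length hs. w i * w i) \<le> 2 * (\<Sum>(i, j)\<in>E. w i * w j)"
  shows "carries G (set hs) q"
proof -
  define m where "m = length hs"
  define g where "g = inv_into {..<m} ((!) hs)"
  define f where "f u = (if u \<in> set hs then w (g u) else 0)" for u
  have bij: "bij_betw ((!) hs) {..<m} (set hs)" using hs(1) by (intro bij_betw_nth) (auto simp: m_def)
  have f_nth: "f (hs ! i) = w i" if "i < m" for i
    using that bij by (auto simp: f_def g_def bij_betw_def m_def)
  have f_nonneg: "0 \<le> f u" for u
  proof (cases "u \<in> set hs")
    case True
    then obtain i where "i < m" "u = hs ! i" by (auto simp: in_set_conv_nth m_def)
    then show ?thesis using f_nth w by (simp add: m_def)
  qed (simp add: f_def)
  note fin = pair_graph_finite[OF G]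
  have norm: "(\<Sum>u\<in>pverts G. f u * f u) = (\<Sum>i<m. w i * w i)"
  proof -
    have "(\<Sum>u\<in>pverts G. f u * f u) = (\<Sum>u\<in>set hs. f u * f u)"
      by (rule sum.mono_neutral_right) (use fin hs in \<open>auto simp: f_def\<close>)
    also have "\<dots> = (\<Sum>i<m. f (hs ! i) * f (hs ! i))"
      by (rule sum.reindex_bij_betw[OF bij, symmetric])
    finally show ?thesis by (simp add: f_nth)
  qed
  have "E \<subseteq> {..<m} \<times> {..<m}" using E by (fastforce simp: m_def)
  then have finE: "finite E" by (rule finite_subset) simp
  let ?h = "\<lambda>(i, j). (hs ! i, hs ! j)"
  have sub: "?h ` (E \<union> E\<inverse>) \<subseteq> parcs G"
    using E pair_graph_symmetric[OF G] by auto
  have inj: "inj_on ?h (E \<union> E\<inverse>)"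
  proof (rule inj_on_subset)
    show "inj_on ?h ({..<m} \<times> {..<m})"
      using bij by (auto simp: inj_on_def bij_betw_def)
    show "E \<union> E\<inverse> \<subseteq> {..<m} \<times> {..<m}" using E by (fastforce simp: m_def)
  qed
  have "2 * (\<Sum>(i, j)\<in>E. w i * w j) = (\<Sum>(i, j)\<in>E. w i * w j) + (\<Sum>(i, j)\<in>E\<inverse>. w i * w j)"
  proof -
    have "(\<Sum>(i, j)\<in>E\<inverse>. w i * w j) = (\<Sum>(i, j)\<in>E. w i * w j)"
      by (rule sum.reindex_bij_witness[of _ prod.swap prod.swap]) (auto simp: mult.commute)
    then show ?thesis by simp
  qed
  also have "\<dots> = (\<Sum>(i, j)\<in>E \<union> E\<inverse>. w i * w j)"
  proof (rule sum.union_disjoint[symmetric])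
    have "(b, a) \<notin> E" if "(a, b) \<in> E" for a b using E[of a b] E[of b a] that by auto
    then show "E \<inter> E\<inverse> = {}" by auto
  qed (use finE in auto)
  also have "\<dots> = (\<Sum>e\<in>E \<union> E\<inverse>. f (fst (?h e)) * f (snd (?h e)))"
    by (rule sum.cong[OF refl]) (use E in \<open>fastforce simp: f_nth m_def\<close>)
  also have "\<dots> = (\<Sum>e\<in>?h ` (E \<union> E\<inverse>). f (fst e) * f (snd e))"
    by (simp add: sum.reindex[OF inj])
  also have "\<dots> \<le> (\<Sum>e\<in>parcs G. f (fst e) * f (snd e))"
    by (rule sum_mono2) (use sub fin in \<open>auto intro!: mult_nonneg_nonneg f_nonneg\<close>)
  finally have "q * (\<Sum>u\<in>pverts G. f u * f u) \<le> (\<Sum>(u, v)\<in>parcs G. f u * f v)"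
    using q norm by (simp add: m_def case_prod_beta)
  then show ?thesis
    unfolding carries_def using pos norm by (intro exI[of _ f]) (auto simp: f_def m_def)
qed

section \<open>Paths and their Rayleigh quotients\<close>

definition graph_path :: "'a pair_pre_digraph \<Rightarrow> 'a list \<Rightarrow> bool" where
  "graph_path G p \<longleftrightarrow> distinct p \<and> set p \<subseteq> pverts G \<and>
     (\<forall>i. Suc i < length p \<longrightarrow> (p ! i, p ! Suc i) \<in> parcs G)"

text \<open>The three-term identity, multiplied by its middle term and summed along the path. The
  separate product on the left is a boundary term, which vanishes for \<theta> = pi / (m +
  2).\<close>

lemma sum_sin_products:
  "2 * (\<Sum>i<m. sin ((real i + 1) * \<theta>) * sin ((real i + 2) * \<theta>))
     + sin ((real m + 1) * \<theta>) * sin ((real m + 2) * \<theta>)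
   = 2 * cos \<theta> * (\<Sum>i<Suc m. sin ((real i + 1) * \<theta>) * sin ((real i + 1) * \<theta>))"
proof (induction m)
  case 0
  then show ?case by (simp add: sin_double)
next
  case (Suc m)
  have "sin ((real m + 3) * \<theta>) + sin ((real m + 1) * \<theta>) = 2 * cos \<theta> * sin ((real m + 2) * \<theta>)"
    using sin_three_term[of "real m + 2" \<theta>] by (simp add: algebra_simps)
  moreover have "d * a + b * d = 2 * c * (d * d)" if "a + b = 2 * c * d" for a b c d :: real
  proof -
    have "d * a + b * d = d * (a + b)" by (simp add: distrib_left mult.commute)
    then show ?thesis by (simp add: that)
  qed
  ultimately have "sin ((real m + 2) * \<theta>) * sin ((real m + 3) * \<theta>) + sin ((real m + 1) * \<theta>) * sin ((real m + 2) * \<theta>)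
     = 2 * cos \<theta> * (sin ((real m + 2) * \<theta>) * sin ((real m + 2) * \<theta>))"
    by blast
  then show ?case using Suc by (simp add: algebra_simps)
qed

text \<open>The weights form the Perron vector of a path. Their positivity makes them usable even if
  the path has chords in \<open>G\<close>.\<close>

lemma carries_graph_path:
  assumes G: "pair_graph G" and p: "graph_path G p" "p \<noteq> []"
  shows "carries G (set p) (2 * cos (pi / (real (length p) + 1)))"
proof -
  obtain m where m: "length p = Suc m" using p(2) by (cases p) auto
  define \<theta> where "\<theta> = pi / (real (length p) + 1)"
  define w where "w i = sin ((real i + 1) * \<theta>)" for i
  have w_pos: "0 < w i" if "i < length p" for i
    unfolding w_def
  proof (rule sin_gt_zero)
    show "0 < (real i + 1) * \<theta>" by (auto simp: \<theta>_def intro!: mult_pos_pos divide_pos_pos)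
    show "(real i + 1) * \<theta> < pi" using that by (simp add: \<theta>_def field_simps)
  qed
  have "real (length p) + 1 = real m + 2" by (simp add: m)
  moreover have "(real m + 2) * (pi / (real m + 2)) = pi"
    by (rule nonzero_mult_div_cancel_left[of "real m + 2" pi, folded times_divide_eq_right]) linarith
  ultimately have "(real m + 2) * \<theta> = pi" by (simp only: \<theta>_def)
  then have "sin ((real m + 2) * \<theta>) = 0" by simp
  moreover have "w (Suc i) = sin ((real i + 2) * \<theta>)" for i
    by (simp add: w_def add.commute)
  ultimately have "2 * (\<Sum>i<m. w i * w (Suc i)) = 2 * cos \<theta> * (\<Sum>i<Suc m. w i * w i)"
    using sum_sin_products[where m = m and \<theta> = \<theta>] by (simp add: w_def)
  moreover have "(\<Sum>(i, j)\<in>(\<lambda>i. (i, Suc i)) ` {..<m}. w i * w j) = (\<Sum>i<m. w i * w (Suc i))"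
    by (subst sum.reindex) (auto simp: inj_on_def)
  moreover have "0 < (\<Sum>i<length p. w i * w i)"
    by (rule sum_pos) (use w_pos m in auto)
  ultimately show ?thesis
    unfolding \<theta>_def[symmetric]
    by (intro carries_embedding[OF G, where w = w and E = "(\<lambda>i. (i, Suc i)) ` {..<m}"])
      (use p w_pos m in \<open>auto simp: graph_path_def less_imp_le\<close>)
qed

lemma graph_path_segment:
  assumes "graph_path G p" shows "graph_path G (take m (drop l p))"
  using assms unfolding graph_path_def
  by (auto simp: distinct_drop dest!: in_set_takeD in_set_dropD)

text \<open>The blocks are disjoint, so every block that \<open>S\<close> meets can be charged to a
  vertex of \<open>S\<close> of its own. With \<open>card S\<close> spare blocks, k - 1 blocks
  remain untouched. The block length \<open>R\<close> is a parameter because the star with five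
  leaves manages with shorter blocks than the other small graphs.\<close>

lemma eigenvalue_sum_ge_heavy:
  assumes G: "pair_graph G" and p: "graph_path G p" and S: "finite S" "carries G S (2 + \<delta>)"
    and "1 \<le> k" "1 \<le> R" and len: "(k - 1 + card S) * R \<le> length p"
    and \<delta>: "real (k - 1) * (2 - 2 * cos (pi / (real R + 1))) \<le> \<delta>"
  shows "2 * real k \<le> eigenvalue_sum k G"
proof -
  define N where "N = k - 1 + card S"
  define b where "b t = take R (drop (t * R) p)" for t
  have le: "t * R + R \<le> length p" if "t < N" for t
  proof -
    have "Suc t * R \<le> N * R" using that by (intro mult_le_mono1) simp
    then show ?thesis using len by (simp add: N_def)
  qed
  have len_b: "length (b t) = R" if "t < N" for t
    using le[OF that] by (simp add: b_def)
  have disj: "set (b s) \<inter> set (b t) = {}" if "s < t" "t < N" for s t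
  proof -
    have "Suc s * R \<le> t * R" using that(1) by (intro mult_le_mono1) simp
    then have "s * R + R \<le> t * R" by simp
    then have "set (b s) \<subseteq> set (take (t * R) p)"
    proof -
      have "b s = drop (s * R) (take (s * R + R) p)" by (simp add: b_def take_drop add.commute)
      also have "set \<dots> \<subseteq> set (take (s * R + R) p)" by (rule set_drop_subset)
      also have "\<dots> \<subseteq> set (take (t * R) p)" by (rule set_take_subset_set_take) fact
      finally show ?thesis .
    qed
    moreover have "set (b t) \<subseteq> set (drop (t * R) p)" by (simp add: b_def set_take_subset)
    moreover have "set (take (t * R) p) \<inter> set (drop (t * R) p) = {}"
      using p by (auto simp: graph_path_def intro!: set_take_disj_set_drop_if_distinct)
    ultimately show ?thesis by blast
  qed
  define T where "T = {t. t < N \<and> set (b t) \<inter> S \<noteq> {}}"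
  have "\<exists>c. \<forall>t. t \<in> T \<longrightarrow> c t \<in> set (b t) \<inter> S"
    by (intro choice) (auto simp: T_def)
  then obtain c where c: "\<And>t. t \<in> T \<Longrightarrow> c t \<in> set (b t) \<inter> S" by blast
  have "inj_on c T"
  proof (rule inj_onI)
    fix s t assume st: "s \<in> T" "t \<in> T" "c s = c t"
    show "s = t"
    proof (rule ccontr)
      assume "s \<noteq> t"
      then have "set (b s) \<inter> set (b t) = {}"
        using disj[of s t] disj[of t s] st by (cases "s < t") (auto simp: T_def)
      then show False using c[OF st(1)] c[OF st(2)] st(3) by auto
    qed
  qed
  then have "card T \<le> card S"
    using c S(1) by (intro card_inj_on_le[of c]) auto
  moreover have "T \<subseteq> {..<N}" by (auto simp: T_def)
  ultimately have "card {..<k - 1} \<le> card ({..<N} - T)"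
    by (simp add: card_Diff_subset finite_subset N_def)
  then obtain h where h: "h ` {..<k - 1} \<subseteq> {..<N} - T" "inj_on h {..<k - 1}"
    using card_le_inj[of "{..<k - 1}" "{..<N} - T"] by auto
  have hN: "h i < N" "h i \<notin> T" if "Suc i < k" for i
  proof -
    have "i < k - 1" using that by simp
    then show "h i < N" "h i \<notin> T" using h(1) by blast+
  qed
  have h_inj: "h i \<noteq> h j" if "i < j" "Suc j < k" for i j
  proof -
    have "i < k - 1" "j < k - 1" using that by simp_all
    then show ?thesis using inj_onD[OF h(2), of i j] that(1) by auto
  qed
  define X where "X t = (case t of 0 \<Rightarrow> S | Suc i \<Rightarrow> set (b (h i)))" for t
  define q where "q t = (case t of 0 \<Rightarrow> 2 + \<delta> | Suc i \<Rightarrow> 2 * cos (pi / (real R + 1)))" for t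
  have "(\<Sum>t<k. q t) \<le> eigenvalue_sum k G"
  proof (rule eigenvalue_sum_ge_disjoint[OF G, where S = X])
    fix t assume t: "t < k"
    show "carries G (X t) (q t)"
    proof (cases t)
      case (Suc i)
      then have "length (b (h i)) = R" using len_b hN(1) t by simp
      moreover from this have "b (h i) \<noteq> []" using \<open>1 \<le> R\<close> by auto
      moreover have "graph_path G (b (h i))" unfolding b_def by (rule graph_path_segment[OF p])
      ultimately show ?thesis using carries_graph_path[OF G, of "b (h i)"] Suc
        by (simp add: X_def q_def)
    qed (use S in \<open>simp add: X_def q_def\<close>)
  next
    fix s t assume st: "s < t" "t < k"
    then obtain j where j: "t = Suc j" by (cases t) auto
    have hj: "h j < N" "h j \<notin> T" using hN[of j] st j by auto
    show "X s \<inter> X t = {}"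
    proof (cases s)
      case 0
      then show ?thesis using hj j by (auto simp: X_def T_def)
    next
      case (Suc i)
      then have "h i < N" "h i \<noteq> h j" using hN(1)[of i] h_inj[of i j] st j by auto
      then show ?thesis using disj[of "h i" "h j"] disj[of "h j" "h i"] hj Suc j
        by (cases "h i < h j") (auto simp: X_def)
    qed
  qed
  moreover have "(\<Sum>t<k. q t) = 2 + \<delta> + real (k - 1) * (2 * cos (pi / (real R + 1)))"
  proof -
    obtain l where "k = Suc l" using \<open>1 \<le> k\<close> by (cases k) auto
    then show ?thesis by (simp add: q_def sum.lessThan_Suc_shift del: sum.lessThan_Suc)
  qed
  moreover have "2 * real k = 2 + 2 * real (k - 1)" using \<open>1 \<le> k\<close> by (simp add: of_nat_diff)
  moreover have "real (k - 1) * (2 - 2 * cos (pi / (real R + 1)))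
      = 2 * real (k - 1) - real (k - 1) * (2 * cos (pi / (real R + 1)))"
    by (simp only: right_diff_distrib mult.commute[of _ 2])
  ultimately show ?thesis using \<delta> by linarith
qed

section \<open>Vertices of large degree\<close>

lemma carries_singleton:
  assumes "pair_graph G" "u \<in> pverts G" shows "carries G {u} 0"
  using carries_embedding[OF assms(1), of "[u]" "\<lambda>_. 1" "{}" 0] assms(2) by simp

text \<open>The leaves get weight 1 and the centre \<open>c\<close>. The best centre weight is the
  square root of the degree; leaving \<open>c\<close> free allows an integer equal or close to
  it.\<close>

lemma carries_star:
  assumes G: "pair_graph G" and x: "x \<in> pverts G"
    and N: "finite N" "N \<subseteq> {y. (x, y) \<in> parcs G}" and "0 < c"
  shows "carries G (insert x N) (2 * c * real (card N) / (c\<^sup>2 + real (card N)))"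
proof -
  obtain ys where ys: "distinct ys" "set ys = N" using finite_distinct_list[OF N(1)] by blast
  then have card: "card N = length ys" using distinct_card[OF ys(1)] by simp
  define w where "w i = (case i of 0 \<Rightarrow> c | Suc _ \<Rightarrow> 1)" for i :: nat
  have "(\<Sum>i<length (x # ys). w i * w i) = c\<^sup>2 + real (card N)"
    by (simp add: w_def sum.lessThan_Suc_shift card power2_eq_square del: sum.lessThan_Suc)
  moreover have "(\<Sum>(i, j)\<in>(\<lambda>i. (0, Suc i)) ` {..<length ys}. w i * w j) = c * real (card N)"
    by (subst sum.reindex) (auto simp: inj_on_def w_def card)
  moreover have "0 < c\<^sup>2 + real (card N)" using \<open>0 < c\<close> by (simp add: add_pos_nonneg)
  moreover have "distinct (x # ys)" "set (x # ys) \<subseteq> pverts G"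
    using ys N(2) x pair_graph_verts[OF G, of x] by auto
  moreover have "(x, ys ! i) \<in> parcs G" if "i < length ys" for i
    using N(2) nth_mem[OF that] ys(2) by auto
  ultimately have "carries G (set (x # ys)) (2 * c * real (card N) / (c\<^sup>2 + real (card N)))"
    by (intro carries_embedding[OF G, where w = w and E = "(\<lambda>i. (0, Suc i)) ` {..<length ys}"])
      (use \<open>0 < c\<close> in \<open>auto simp: w_def split: nat.split\<close>)
  then show ?thesis using ys by simp
qed

text \<open>The star alone reaches 2k, so the other k - 1 vectors can be single vertices of quotient
  0. No path is involved, which is why this can come before any bound on the degrees. The star takes
  4 k^2 + 1 vertices and k - 1 more have to be left over.\<close>

lemma eigenvalue_sum_ge_large_degree:
  assumes G: "pair_graph G" and x: "x \<in> pverts G" and "1 \<le> k"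
    and deg: "4 * k\<^sup>2 \<le> card {y. (x, y) \<in> parcs G}" and n: "4 * k\<^sup>2 + k \<le> card (pverts G)"
  shows "2 * real k \<le> eigenvalue_sum k G"
proof -
  obtain N where N: "N \<subseteq> {y. (x, y) \<in> parcs G}" "card N = 4 * k\<^sup>2" "finite N"
    using obtain_subset_with_card_n[OF deg] by blast
  have "N \<subseteq> pverts G" using N pair_graph_verts[OF G] by auto
  have "card (insert x N) \<le> 4 * k\<^sup>2 + 1" using N by (simp add: card_insert_if)
  then have "card {..<k - 1} \<le> card (pverts G - insert x N)"
    using n diff_card_le_card_Diff[of "insert x N" "pverts G"] N by simp
  then obtain h where h: "h ` {..<k - 1} \<subseteq> pverts G - insert x N" "inj_on h {..<k - 1}"
    using card_le_inj[of "{..<k - 1}" "pverts G - insert x N"] pair_graph_finite[OF G] by auto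
  define X where "X t = (case t of 0 \<Rightarrow> insert x N | Suc i \<Rightarrow> {h i})" for t
  define q where "q t = (case t of 0 \<Rightarrow> 2 * real k | Suc i \<Rightarrow> 0)" for t :: nat
  have "carries G (insert x N) (2 * real k)"
  proof -
    \<comment> \<open>The optimal centre weight: 2k is the square root of the number of
      leaves.\<close>
    have "2 * (2 * real k) * real (card N) / ((2 * real k)\<^sup>2 + real (card N)) = 2 * real k"
      using \<open>1 \<le> k\<close> by (simp add: N(2) field_simps power2_eq_square)
    then show ?thesis using carries_star[OF G x N(3,1), of "2 * real k"] \<open>1 \<le> k\<close> by simp
  qed
  moreover have "carries G {h i} 0" if "i < k - 1" for i
    using h that by (intro carries_singleton[OF G]) auto
  moreover have "h i \<notin> insert x N" if "i < k - 1" for i using h(1) that by blast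
  moreover have "h j \<noteq> h i" if "i < j" "j < k - 1" for i j
    using inj_onD[OF h(2), of i j] that by auto
  ultimately have "(\<Sum>t<k. q t) \<le> eigenvalue_sum k G"
    by (intro eigenvalue_sum_ge_disjoint[OF G, where S = X])
      (auto simp: X_def q_def split: nat.split)
  moreover obtain l where "k = Suc l" using \<open>1 \<le> k\<close> by (cases k) auto
  then have "(\<Sum>t<k. q t) = 2 * real k"
    by (simp add: q_def sum.lessThan_Suc_shift del: sum.lessThan_Suc)
  ultimately show ?thesis by simp
qed

section \<open>Long paths from bounded degrees\<close>

lemma connected_rtrancl:
  assumes G: "pair_graph G" and c: "Digraph_Component.connected (with_proj G)"
    and "u \<in> pverts G" "v \<in> pverts G"
  shows "(u, v) \<in> (parcs G)\<^sup>*"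
proof -
  have "parcs (mk_symmetric (with_proj G)) = parcs G"
    using pair_graph_symmetric[OF G] by (auto simp: parcs_mk_symmetric)
  then have "(u, v) \<in> rtrancl_on (pverts G) (parcs G)"
    using assms by (auto simp: connected_def strongly_connected_def reachable_def)
  then show ?thesis by (rule rtrancl_on_rtranclI)
qed

text \<open>Enlarging the radius by one replaces each vertex by itself and at most d neighbours. The
  crude base d + 1 makes the bound a pure power, which is easy to compare with a power of 2 k +
  1.\<close>

lemma ball_card:
  assumes G: "pair_graph G" and deg: "\<And>v. v \<in> pverts G \<Longrightarrow> card {y. (v, y) \<in> parcs G} \<le> d"
    and u: "u \<in> pverts G"
  shows "finite {v. \<exists>i\<le>D. (u, v) \<in> parcs G ^^ i} \<and> {v. \<exists>i\<le>D. (u, v) \<in> parcs G ^^ i} \<subseteq> pverts G \<and>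
    card {v. \<exists>i\<le>D. (u, v) \<in> parcs G ^^ i} \<le> (d + 1) ^ D"
proof (induction D)
  case 0
  then show ?case using u by simp
next
  case (Suc D)
  define B where "B = {v. \<exists>i\<le>D. (u, v) \<in> parcs G ^^ i}"
  have finN: "finite {y. (v, y) \<in> parcs G}" for v
    by (rule finite_subset[OF _ pair_graph_finite(1)[OF G]]) (use pair_graph_verts[OF G] in auto)
  have eq: "{v. \<exists>i\<le>Suc D. (u, v) \<in> parcs G ^^ i} = (\<Union>v\<in>B. insert v {y. (v, y) \<in> parcs G})"
  proof (intro equalityI subsetI)
    fix y assume "y \<in> {v. \<exists>i\<le>Suc D. (u, v) \<in> parcs G ^^ i}"
    then obtain i where i: "i \<le> Suc D" "(u, y) \<in> parcs G ^^ i" by auto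
    show "y \<in> (\<Union>v\<in>B. insert v {y. (v, y) \<in> parcs G})"
    proof (cases "i \<le> D")
      case True
      then show ?thesis using i by (auto simp: B_def)
    next
      case False
      then have "i = Suc D" using i by simp
      then obtain v where "(u, v) \<in> parcs G ^^ D" "(v, y) \<in> parcs G" using i by auto
      then show ?thesis by (auto simp: B_def)
    qed
  next
    fix y assume "y \<in> (\<Union>v\<in>B. insert v {y. (v, y) \<in> parcs G})"
    then obtain v i where vi: "i \<le> D" "(u, v) \<in> parcs G ^^ i" "y = v \<or> (v, y) \<in> parcs G"
      by (auto simp: B_def)
    then consider "(u, y) \<in> parcs G ^^ i" | "(u, y) \<in> parcs G ^^ Suc i" by auto
    then show "y \<in> {v. \<exists>i\<le>Suc D. (u, v) \<in> parcs G ^^ i}"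
    proof cases
      case 1
      then show ?thesis using vi(1) by (intro CollectI exI[of _ i]) simp
    next
      case 2
      then show ?thesis using vi(1) by (intro CollectI exI[of _ "Suc i"]) simp
    qed
  qed
  have B: "finite B" "B \<subseteq> pverts G" "card B \<le> (d + 1) ^ D" using Suc by (auto simp: B_def)
  have "card (insert v {y. (v, y) \<in> parcs G}) \<le> d + 1" if "v \<in> B" for v
    using deg[of v] that B(2) finN[of v] by (auto simp: card_insert_if)
  then have "card (\<Union>v\<in>B. insert v {y. (v, y) \<in> parcs G}) \<le> card B * (d + 1)"
    using card_UN_le[OF B(1), of "\<lambda>v. insert v {y. (v, y) \<in> parcs G}"]
      sum_bounded_above[of B "\<lambda>v. card (insert v {y. (v, y) \<in> parcs G})" "d + 1"] by simp
  also have "\<dots> \<le> (d + 1) ^ Suc D" using mult_le_mono1[OF B(3), of "d + 1"] by (simp add: mult.commute)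
  finally show ?case using eq B finN pair_graph_verts[OF G] by auto
qed

text \<open>The ball of radius \<open>D\<close> does not exhaust the graph, and a shortest walk to a
  vertex outside it is a path with at least D + 2 vertices.\<close>

lemma long_graph_path:
  assumes G: "pair_graph G" and c: "Digraph_Component.connected (with_proj G)"
    and deg: "\<And>v. v \<in> pverts G \<Longrightarrow> card {y. (v, y) \<in> parcs G} \<le> d"
    and n: "(d + 1) ^ D < card (pverts G)"
  obtains p where "graph_path G p" "D + 2 \<le> length p"
proof -
  obtain u where u: "u \<in> pverts G" using n by fastforce
  let ?B = "{v. \<exists>i\<le>D. (u, v) \<in> parcs G ^^ i}"
  note ball = ball_card[OF G deg u, of D]
  have "?B \<subseteq> pverts G" "card ?B \<le> (d + 1) ^ D" using ball by blast+
  then have "?B \<noteq> pverts G" using n by (metis not_le)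
  with \<open>?B \<subseteq> pverts G\<close> obtain v where v: "v \<in> pverts G" "v \<notin> ?B" by blast
  have "\<exists>m. (u, v) \<in> parcs G ^^ m"
    using connected_rtrancl[OF G c u v(1)] by (simp add: rtrancl_power)
  define m where "m = (LEAST m. (u, v) \<in> parcs G ^^ m)"
  have m: "(u, v) \<in> parcs G ^^ m" "\<And>i. (u, v) \<in> parcs G ^^ i \<Longrightarrow> m \<le> i"
    unfolding m_def by (rule LeastI_ex, fact) (rule Least_le)
  have "D < m" using v(2) m(1) by (auto simp: not_le)
  obtain f where f: "f 0 = u" "f m = v" "\<And>i. i < m \<Longrightarrow> (f i, f (Suc i)) \<in> parcs G"
    using m(1) unfolding relpow_fun_conv by auto
  have seg: "(f i, f (i + l)) \<in> parcs G ^^ l" if "i + l \<le> m" for i l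
    unfolding relpow_fun_conv using that f(3) by (intro exI[of _ "\<lambda>j. f (i + j)"]) auto
  \<comment> \<open>A repetition could be cut out, leaving a walk of length i + (m - j) < m.\<close>
  have inj: "f i \<noteq> f j" if "i < j" "j \<le> m" for i j
  proof
    assume eq: "f i = f j"
    have "(f 0, f (0 + i)) \<in> parcs G ^^ i" "(f j, f (j + (m - j))) \<in> parcs G ^^ (m - j)"
      using that by (intro seg; simp)+
    then have "(u, v) \<in> parcs G ^^ i O parcs G ^^ (m - j)"
      using eq f(1,2) that by auto
    then have "m \<le> i + (m - j)" unfolding relpow_add[symmetric] by (rule m(2))
    then show False using that by simp
  qed
  have verts: "f i \<in> pverts G" if "i \<le> m" for i
  proof (cases i)
    case 0
    then show ?thesis using f(1) u by simp
  next
    case (Suc j)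
    then show ?thesis using f(3)[of j] that by (auto dest: pair_graph_verts(2)[OF G])
  qed
  have "inj_on f {0..<Suc m}"
  proof (rule linorder_inj_onI)
    fix i j assume "i < j" "j \<in> {0..<Suc m}"
    then show "f i \<noteq> f j" by (intro inj) simp_all
  qed auto
  then have "distinct (map f [0..<Suc m])" by (simp add: distinct_map del: upt_Suc)
  moreover have "set (map f [0..<Suc m]) \<subseteq> pverts G" using verts by (auto simp del: upt_Suc)
  ultimately have "graph_path G (map f [0..<Suc m])"
    unfolding graph_path_def using f(3) by (simp del: upt_Suc)
  then show ?thesis using that[of "map f [0..<Suc m]"] \<open>D < m\<close> by simp
qed

section \<open>Graphs without small heavy subgraphs\<close>

text \<open>The threshold \<open>2.005\<close> is below the spectral radius \<open>2.0066\<close> of the tree with arms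
  \<open>1, 2, 6\<close>, and its excess over \<open>2\<close> still covers the total deficiency of \<open>k - 1\<close> paths with
  \<open>2 r + 1\<close> vertices.\<close>

definition heavy :: "'a pair_pre_digraph \<Rightarrow> bool" where
  "heavy G \<longleftrightarrow> (\<exists>S. finite S \<and> card S \<le> 10 \<and> carries G S 2.005)"

lemma heavyI:
  fixes ws :: "real list"
  assumes G: "pair_graph G" and hs: "distinct hs" "set hs \<subseteq> pverts G" "length hs \<le> 10"
    and w: "length ws = length hs" "\<forall>x\<in>set ws. 0 < x" "hs \<noteq> []"
    and E: "\<forall>(i, j)\<in>E. i < j \<and> j < length hs \<and> (hs ! i, hs ! j) \<in> parcs G"
    and q: "2.005 * (\<Sum>x\<leftarrow>ws. x * x) \<le> 2 * (\<Sum>(i, j)\<in>E. ws ! i * ws ! j)"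
  shows "heavy G"
proof -
  have sum: "(\<Sum>i<length hs. ws ! i * ws ! i) = (\<Sum>x\<leftarrow>ws. x * x)"
    using w(1) by (simp add: sum_list_sum_nth lessThan_atLeast0)
  have "carries G (set hs) 2.005"
  proof (rule carries_embedding[OF G hs(1,2), where w = "(!) ws" and E = E])
    show "0 < (\<Sum>i<length hs. ws ! i * ws ! i)"
      using w by (intro sum_pos) auto
  qed (use w E q sum in \<open>auto simp: less_imp_le\<close>)
  then show ?thesis unfolding heavy_def using hs distinct_card[OF hs(1)]
    by (intro exI[of _ "set hs"]) auto
qed

text \<open>The star with four leaves has the eigenvector 2, 1, 1, 1, 1 for its radius 2. Doubled,
  and with weight 1 at the additional vertex, it gives the quotient 68/33.\<close>

lemma heavy_star_pendant:
  assumes G: "pair_graph G" and d: "distinct [x, a, b, c, d, e]"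
    and E: "(x, a) \<in> parcs G" "(x, b) \<in> parcs G" "(x, c) \<in> parcs G" "(x, d) \<in> parcs G" "(a, e) \<in> parcs G"
  shows "heavy G"
  by (rule heavyI[OF G d, where ws = "[4, 2, 2, 2, 2, 1]" and E = "{(0, 1), (0, 2), (0, 3), (0, 4), (1, 5)}"])
    (use E pair_graph_verts[OF G] in auto)

text \<open>The constant vector has quotient 2 on the triangle; half of its value at the pendant
  vertex raises the quotient to 28/13.\<close>

lemma heavy_triangle_pendant:
  assumes G: "pair_graph G" and d: "distinct [a, b, x, y]"
    and E: "(a, b) \<in> parcs G" "(a, x) \<in> parcs G" "(b, x) \<in> parcs G" "(x, y) \<in> parcs G"
  shows "heavy G"
  by (rule heavyI[OF G d, where ws = "[2, 2, 2, 1]" and E = "{(0, 1), (0, 2), (1, 2), (2, 3)}"])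
    (use E pair_graph_verts[OF G] in auto)

text \<open>The weights are a rounded Perron vector of the tree with arms \<open>1, 2, 6\<close> at \<open>x\<close>.\<close>

lemma heavy_E10:
  assumes G: "pair_graph G" and d: "distinct [w, u2, u1, x, z1, z2, z3, z4, z5, z6]"
    and E: "(w, x) \<in> parcs G" "(u2, u1) \<in> parcs G" "(u1, x) \<in> parcs G" "(x, z1) \<in> parcs G"
      "(z1, z2) \<in> parcs G" "(z2, z3) \<in> parcs G" "(z3, z4) \<in> parcs G" "(z4, z5) \<in> parcs G"
      "(z5, z6) \<in> parcs G"
  shows "heavy G"
  by (rule heavyI[OF G d, where ws = "[7, 5, 9, 14, 12, 10, 8, 6, 4, 2]" and
        E = "{(0, 3), (1, 2), (2, 3), (3, 4), (4, 5), (5, 6), (6, 7), (7, 8), (8, 9)}"])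
    (use E pair_graph_verts[OF G] in auto)

section \<open>Chords of a long path\<close>

lemma graph_path_adj:
  assumes "pair_graph G" "graph_path G p" "a < length p" "b < length p" "b = Suc a \<or> a = Suc b"
  shows "(p ! a, p ! b) \<in> parcs G"
  using assms pair_graph_symmetric[OF assms(1)] by (auto simp: graph_path_def)

lemma distinct_map_nth:
  assumes "distinct p" "distinct is" "\<forall>i\<in>set is. i < length p"
  shows "distinct (map ((!) p) is)"
  using assms by (auto simp: distinct_map inj_on_def nth_eq_iff_index_eq)

lemma graph_path_rev:
  assumes "pair_graph G" "graph_path G p" shows "graph_path G (rev p)"
  using assms unfolding graph_path_def
  by (auto simp: rev_nth intro!: graph_path_adj[OF assms])

lemma graph_path_Cons:
  assumes "graph_path G p" "x \<in> pverts G" "x \<notin> set p" "p \<noteq> [] \<Longrightarrow> (x, hd p) \<in> parcs G"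
  shows "graph_path G (x # p)"
  using assms unfolding graph_path_def by (auto simp: nth_Cons hd_conv_nth split: nat.split)

text \<open>A chord over a single vertex closes a triangle, with the predecessor of
  \<open>p ! i\<close> pendant to it. A longer chord gives the tree with arms 1, 2, 6 centred at one
  of its ends: the chord and one path edge form the arm of length 2, and the long arm runs between
  the ends, before \<open>i\<close> or after \<open>j\<close>. If none of the three has room, then j
  <= i + 7 <= 12 while j > m - 6, contrary to m >= 18.\<close>

lemma chord_heavy_aux:
  assumes G: "pair_graph G" and p: "graph_path G p" "length p = Suc m" "18 \<le> m"
    and c: "(p ! i, p ! j) \<in> parcs G" and ij: "1 \<le> i" "i + 2 \<le> j" "j \<le> m"
  shows "heavy G"
proof -
  note adj = graph_path_adj[OF G p(1)]
  note c' = c[unfolded pair_graph_symmetric[OF G, of "p ! i"]]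
  have dist: "distinct p" using p by (simp add: graph_path_def)
  note d = distinct_map_nth[OF dist]
  consider "j = i + 2" | "i + 8 \<le> j" | "i + 3 \<le> j" "6 \<le> i" | "i + 3 \<le> j" "j + 6 \<le> m"
    using ij p(3) by linarith
  then show ?thesis
  proof cases
    case 1
    have D: "distinct (map ((!) p) [i + 1, j, i, i - 1])" using ij p 1 by (intro d) auto
    show ?thesis
    proof (rule heavy_triangle_pendant[OF G D[unfolded list.map]])
      show "(p ! j, p ! i) \<in> parcs G" by (rule c')
    qed (rule adj; use ij p 1 in arith)+
  next
    case 2
    have D: "distinct (map ((!) p) [i - 1, j - 1, j, i, i + 1, i + 2, i + 3, i + 4, i + 5, i + 6])"
      using ij p 2 by (intro d) auto
    show ?thesis
      by (rule heavy_E10[OF G D[unfolded list.map]]; (rule c' | (rule adj; use ij p 2 in arith)))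
  next
    case 3
    have D: "distinct (map ((!) p) [i + 1, j - 1, j, i, i - 1, i - 2, i - 3, i - 4, i - 5, i - 6])"
      using ij p 3 by (intro d) auto
    show ?thesis
      by (rule heavy_E10[OF G D[unfolded list.map]]; (rule c' | (rule adj; use ij p 3 in arith)))
  next
    case 4
    have D: "distinct (map ((!) p) [j - 1, i + 1, i, j, j + 1, j + 2, j + 3, j + 4, j + 5, j + 6])"
      using ij p 4 by (intro d) auto
    show ?thesis
      by (rule heavy_E10[OF G D[unfolded list.map]]; (rule c | (rule adj; use ij p 4 in arith)))
  qed
qed

text \<open>A chord at the first vertex has no predecessor to use. Seen from the other end of the
  path it starts at a positive index, except when it joins both ends.\<close>

lemma chord_heavy:
  assumes G: "pair_graph G" and p: "graph_path G p" "length p = Suc m" "18 \<le> m"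
    and c: "(p ! i, p ! j) \<in> parcs G" and ij: "i + 2 \<le> j" "j \<le> m" "i \<noteq> 0 \<or> j \<noteq> m"
  shows "heavy G"
proof (cases "i = 0")
  case False
  then show ?thesis using chord_heavy_aux[OF G p c] ij by simp
next
  case True
  have "(rev p ! (m - j), rev p ! (m - i)) \<in> parcs G"
    using c ij p(2) pair_graph_symmetric[OF G] by (simp add: rev_nth)
  then show ?thesis
    using chord_heavy_aux[OF G graph_path_rev[OF G p(1)], of m "m - j" "m - i"] ij p True by simp
qed

lemma path_arcs:
  assumes G: "pair_graph G" and p: "graph_path G p" "length p = Suc m" "18 \<le> m"
    and h: "\<not> heavy G" and ij: "i \<le> m" "j \<le> m"
  shows "(p ! i, p ! j) \<in> parcs G \<longleftrightarrow> j = Suc i \<or> i = Suc j \<or>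
    ((i = 0 \<and> j = m \<or> i = m \<and> j = 0) \<and> (p ! 0, p ! m) \<in> parcs G)"
proof
  assume e: "(p ! i, p ! j) \<in> parcs G"
  then have ne: "i \<noteq> j" using pair_graph_verts(3)[OF G] by auto
  have e': "(p ! j, p ! i) \<in> parcs G" using e pair_graph_symmetric[OF G] by blast
  show "j = Suc i \<or> i = Suc j \<or>
    ((i = 0 \<and> j = m \<or> i = m \<and> j = 0) \<and> (p ! 0, p ! m) \<in> parcs G)"
  proof (rule ccontr)
    assume n: "\<not> ?thesis"
    then consider "i + 2 \<le> j" "i \<noteq> 0 \<or> j \<noteq> m" | "j + 2 \<le> i" "j \<noteq> 0 \<or> i \<noteq> m"
      using ne e e' by (metis add_2_eq_Suc' linorder_neqE_nat not_less_eq_eq Suc_leI le_antisym)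
    then show False
      using chord_heavy[OF G p e] chord_heavy[OF G p e'] h ij by cases auto
  qed
next
  assume "j = Suc i \<or> i = Suc j \<or>
    ((i = 0 \<and> j = m \<or> i = m \<and> j = 0) \<and> (p ! 0, p ! m) \<in> parcs G)"
  then show "(p ! i, p ! j) \<in> parcs G"
    using graph_path_adj[OF G p(1), of i j] ij p(2) pair_graph_symmetric[OF G] by auto
qed

section \<open>Vertices off a longest path\<close>

definition longest_path :: "'a pair_pre_digraph \<Rightarrow> 'a list \<Rightarrow> bool" where
  "longest_path G p \<longleftrightarrow> graph_path G p \<and> (\<forall>q. graph_path G q \<longrightarrow> length q \<le> length p)"

lemma longest_path_rev:
  assumes "pair_graph G" "longest_path G p" shows "longest_path G (rev p)"
  using assms graph_path_rev by (auto simp: longest_path_def)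

lemma longest_path_exists:
  assumes G: "pair_graph G" and q: "graph_path G q"
  obtains p where "longest_path G p" "length q \<le> length p"
proof -
  have "length p \<le> card (pverts G)" if "graph_path G p" for p
    using that card_mono[OF pair_graph_finite(1)[OF G], of "set p"] distinct_card[of p]
    by (auto simp: graph_path_def)
  then obtain p where "graph_path G p" "\<And>q. graph_path G q \<Longrightarrow> length q \<le> length p"
    using ex_has_greatest_nat[of "graph_path G" q length "Suc (card (pverts G))"] q by (auto simp: less_Suc_eq_le)
  then show ?thesis using that[of p] q by (auto simp: longest_path_def)
qed

text \<open>At an end of the path, \<open>w\<close> would prolong it. At distance at least two from
  both ends, \<open>w\<close> is the arm of length 1 of a heavy tree whose other arms run two steps
  along the path one way and six the other; one of the two directions has six vertices to
  spare.\<close>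

lemma off_path_neighbour:
  assumes G: "pair_graph G" and l: "longest_path G p" and p: "length p = Suc m" "18 \<le> m"
    and h: "\<not> heavy G" and w: "w \<notin> set p" "(w, p ! j) \<in> parcs G" and j: "j \<le> m"
  shows "j = 1 \<or> j = m - 1"
proof (rule ccontr)
  assume neg: "\<not> (j = 1 \<or> j = m - 1)"
  have gp: "graph_path G p" using l by (simp add: longest_path_def)
  note adj = graph_path_adj[OF G gp]
  have dist: "distinct p" using gp by (simp add: graph_path_def)
  have wv: "w \<in> pverts G" using w pair_graph_verts[OF G] by blast
  have d: "distinct (w # map ((!) p) is)" if "distinct is" "\<forall>i\<in>set is. i < length p" for "is"
    using distinct_map_nth[OF dist that] that(2) w(1) by auto
  have "j \<noteq> 0"
  proof
    assume "j = 0"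
    then have "graph_path G (w # p)"
      using w wv p by (intro graph_path_Cons[OF gp]) (auto simp: hd_conv_nth)
    then show False using l by (fastforce simp: longest_path_def)
  qed
  moreover have "j \<noteq> m"
  proof
    assume "j = m"
    then have "graph_path G (w # rev p)"
      using w wv p by (intro graph_path_Cons[OF graph_path_rev[OF G gp]]) (auto simp: hd_rev last_conv_nth)
    then show False using l by (fastforce simp: longest_path_def)
  qed
  ultimately have j2: "2 \<le> j" "j + 2 \<le> m" using neg j by auto
  consider "j + 6 \<le> m" | "6 \<le> j" using p by linarith
  then show False
  proof cases
    case 1
    have D: "distinct (w # map ((!) p) [j - 2, j - 1, j, j + 1, j + 2, j + 3, j + 4, j + 5, j + 6])"
      using j2 p 1 by (intro d) auto
    have "heavy G"
      by (rule heavy_E10[OF G D[unfolded list.map]]; (rule w | (rule adj; use j2 p 1 in arith)))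
    then show False using h by simp
  next
    case 2
    have D: "distinct (w # map ((!) p) [j + 2, j + 1, j, j - 1, j - 2, j - 3, j - 4, j - 5, j - 6])"
      using j2 p 2 by (intro d) auto
    have "heavy G"
      by (rule heavy_E10[OF G D[unfolded list.map]]; (rule w | (rule adj; use j2 p 2 in arith)))
    then show False using h by simp
  qed
qed

text \<open>\<open>w\<close> can replace \<open>p ! 0\<close>, giving another longest path. So a
  neighbour of \<open>w\<close> off \<open>p\<close> would prolong that path, and an edge joining
  the ends of \<open>p\<close> would yield a path through \<open>p ! 0\<close> and \<open>w\<close>
  with one more vertex. A second vertex attached at \<open>p ! 1\<close> creates the star with four
  leaves and a pendant edge. If \<open>w\<close> were adjacent to \<open>p ! (m - 1)\<close> too,
  these two would form the arm of length 2 of a heavy tree centred at \<open>p ! 1\<close>.\<close>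

lemma attached_vertex:
  assumes G: "pair_graph G" and l: "longest_path G p" and p: "length p = Suc m" "18 \<le> m"
    and h: "\<not> heavy G" and w: "w \<notin> set p" "(w, p ! 1) \<in> parcs G"
  shows "y \<notin> set p \<Longrightarrow> (w, y) \<notin> parcs G"
    and "y \<notin> set p \<Longrightarrow> (y, p ! 1) \<in> parcs G \<Longrightarrow> y = w"
    and "(w, p ! (m - 1)) \<notin> parcs G"
    and "(p ! 0, p ! m) \<notin> parcs G"
proof -
  have gp: "graph_path G p" using l by (simp add: longest_path_def)
  note adj = graph_path_adj[OF G gp] and sym = pair_graph_symmetric[OF G]
  have dist: "distinct p" using gp by (simp add: graph_path_def)
  have wv: "w \<in> pverts G" using w pair_graph_verts[OF G] by blast
  have d: "distinct (map ((!) p) is)" "w \<notin> set (map ((!) p) is)"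
    if "distinct is" "\<forall>i\<in>set is. i < length p" for "is"
    using distinct_map_nth[OF dist that] that(2) w(1) by auto
  obtain x t where xt: "p = x # t" using p by (cases p) auto
  have t: "graph_path G t"
    using gp unfolding xt graph_path_def by (auto simp: nth_Cons split: nat.splits)
  have tne: "t \<noteq> []" "hd t = p ! 1" using p xt by (cases t; simp)+
  have wt: "graph_path G (w # t)"
    using w wv tne xt by (intro graph_path_Cons[OF t]) auto
  show "(w, y) \<notin> parcs G" if y: "y \<notin> set p"
  proof
    assume wy: "(w, y) \<in> parcs G"
    then have "graph_path G (y # w # t)"
      using y xt pair_graph_verts[OF G wy] sym wy by (intro graph_path_Cons[OF wt]) auto
    then show False using l xt by (fastforce simp: longest_path_def)
  qed
  show "y = w" if y: "y \<notin> set p" "(y, p ! 1) \<in> parcs G"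
  proof (rule ccontr)
    assume "y \<noteq> w"
    moreover have "distinct (map ((!) p) [1, 2, 0, 3])" "w \<notin> set (map ((!) p) [1, 2, 0, 3])"
      using p by (intro d; simp)+
    moreover have "y \<notin> set (map ((!) p) [1, 2, 0, 3])" using y(1) p by auto
    ultimately have "distinct [p ! 1, p ! 2, p ! 0, w, y, p ! 3]" by auto
    moreover have "(p ! 1, w) \<in> parcs G" "(p ! 1, y) \<in> parcs G" using w(2) y(2) sym by blast+
    moreover have "(p ! 1, p ! 2) \<in> parcs G" "(p ! 1, p ! 0) \<in> parcs G" "(p ! 2, p ! 3) \<in> parcs G"
      using p by (intro adj; simp)+
    ultimately have "heavy G" by (intro heavy_star_pendant[OF G])
    then show False using h by simp
  qed
  show "(w, p ! (m - 1)) \<notin> parcs G"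
  proof
    assume wm: "(w, p ! (m - 1)) \<in> parcs G"
    let ?is = "[0, m - 1, 1, 2, 3, 4, 5, 6, 7]"
    have "distinct ?is" "\<forall>i\<in>set ?is. i < length p" using p by auto
    then have "distinct (map ((!) p) ?is)" "w \<notin> set (map ((!) p) ?is)" using d by blast+
    then have D: "distinct [p ! 0, p ! (m - 1), w, p ! 1, p ! 2, p ! 3, p ! 4, p ! 5, p ! 6, p ! 7]"
      by auto
    have mw: "(p ! (m - 1), w) \<in> parcs G" using wm sym by blast
    have "heavy G"
      by (rule heavy_E10[OF G D]; (rule mw | rule w | (rule adj; use p in arith)))
    then show False using h by simp
  qed
  show "(p ! 0, p ! m) \<notin> parcs G"
  proof
    assume "(p ! 0, p ! m) \<in> parcs G"
    then have "(hd (rev (w # t)), x) \<in> parcs G"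
      using p xt tne sym by (auto simp: hd_rev last_conv_nth)
    moreover have "graph_path G (rev (w # t))" by (rule graph_path_rev[OF G wt])
    ultimately have "graph_path G (x # rev (w # t))"
      using xt dist w gp sym by (intro graph_path_Cons) (auto simp: graph_path_def)
    then show False using l xt by (fastforce simp: longest_path_def)
  qed
qed

text \<open>Bounds on the indices are supplied by \<open>realizes\<close>. In
  \<open>fork_rel\<close> they have to be written out, since the last path vertex and the extra leaf
  have consecutive numbers without being adjacent.\<close>

definition path_rel :: "nat \<Rightarrow> nat \<Rightarrow> bool" where
  "path_rel i j \<longleftrightarrow> j = Suc i \<or> i = Suc j"

definition cycle_rel :: "nat \<Rightarrow> nat \<Rightarrow> nat \<Rightarrow> bool" where
  "cycle_rel m i j \<longleftrightarrow> path_rel i j \<or> i = 0 \<and> j = m \<or> i = m \<and> j = 0"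

text \<open>The extra leaf \<open>m + 1\<close> hangs at the vertex \<open>1\<close> of the path \<open>0, \<dots>, m\<close>, and in
  \<open>double_fork_rel\<close> the leaf \<open>m + 2\<close> hangs at \<open>m - 1\<close>.\<close>

definition fork_rel :: "nat \<Rightarrow> nat \<Rightarrow> nat \<Rightarrow> bool" where
  "fork_rel m i j \<longleftrightarrow> i \<le> m \<and> j \<le> m \<and> path_rel i j \<or> i = 1 \<and> j = m + 1 \<or> i = m + 1 \<and> j = 1"

definition double_fork_rel :: "nat \<Rightarrow> nat \<Rightarrow> nat \<Rightarrow> bool" where
  "double_fork_rel m i j \<longleftrightarrow> fork_rel m i j \<or>
     i = m - 1 \<and> j = m + 2 \<or> i = m + 2 \<and> j = m - 1"

lemma attached_arcs:
  assumes G: "pair_graph G" and l: "longest_path G p" and p: "length p = Suc m" "18 \<le> m"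
    and h: "\<not> heavy G" and w: "w \<notin> set p" "(w, p ! 1) \<in> parcs G" and ij: "i \<le> m + 1" "j \<le> m + 1"
  shows "((p @ [w]) ! i, (p @ [w]) ! j) \<in> parcs G \<longleftrightarrow> fork_rel m i j"
proof -
  note A = attached_vertex[OF G l p h w]
  have gp: "graph_path G p" using l by (simp add: longest_path_def)
  have 1: "(p ! a, p ! b) \<in> parcs G \<longleftrightarrow> path_rel a b" if "a \<le> m" "b \<le> m" for a b
    using path_arcs[OF G gp p h that] A(4) by (simp add: path_rel_def)
  have 2: "(w, p ! a) \<in> parcs G \<longleftrightarrow> a = 1" if "a \<le> m" for a
    using off_path_neighbour[OF G l p h w(1) _ that] w(2) A(3) by auto
  then have 3: "(p ! a, w) \<in> parcs G \<longleftrightarrow> a = 1" if "a \<le> m" for a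
    using that pair_graph_symmetric[OF G] by blast
  have 4: "(w, w) \<notin> parcs G" using A(1) w by blast
  show ?thesis
    using 1[of i j] 2[of j] 3[of i] 4 ij p
    by (cases "i \<le> m"; cases "j \<le> m")
      (auto simp: nth_append fork_rel_def path_rel_def not_le less_Suc_eq_le le_Suc_eq)
qed

text \<open>The path and the vertices attached at \<open>p ! 1\<close> or \<open>p ! (m - 1)\<close>
  form a set closed under adjacency, which by connectedness is everything. The second kind of
  attached vertex is treated on the reversed path.\<close>

lemma spanned_vertices:
  assumes G: "pair_graph G" and c: "Digraph_Component.connected (with_proj G)"
    and l: "longest_path G p" and p: "length p = Suc m" "18 \<le> m" and h: "\<not> heavy G"
    and v: "v \<in> pverts G" "v \<notin> set p"
  shows "(v, p ! 1) \<in> parcs G \<or> (v, p ! (m - 1)) \<in> parcs G"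
proof -
  define A where "A = {w. w \<notin> set p \<and> ((w, p ! 1) \<in> parcs G \<or> (w, p ! (m - 1)) \<in> parcs G)}"
  have gp: "graph_path G p" using l by (simp add: longest_path_def)
  have rev1: "rev p ! 1 = p ! (m - 1)" using p by (simp add: rev_nth)
  have "y \<in> set p \<union> A" if e: "(u, y) \<in> parcs G" "u \<in> set p \<union> A" for u y
  proof (cases "y \<in> set p")
    case False
    show ?thesis
    proof (cases "u \<in> set p")
      case True
      then obtain j where "j \<le> m" "u = p ! j" using p by (auto simp: in_set_conv_nth less_Suc_eq_le)
      moreover have "(y, u) \<in> parcs G" using that pair_graph_symmetric[OF G] by blast
      ultimately show ?thesis using off_path_neighbour[OF G l p h False] False
        by (auto simp: A_def)
    next
      case uF: False
      then consider "(u, p ! 1) \<in> parcs G" | "(u, rev p ! 1) \<in> parcs G"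
        unfolding rev1 using e(2) uF by (auto simp: A_def)
      then have "(u, y) \<notin> parcs G"
      proof cases
        case 1
        then show ?thesis using attached_vertex(1)[OF G l p h uF _ False] by blast
      next
        case 2
        then show ?thesis
          using attached_vertex(1)[OF G longest_path_rev[OF G l] _ p(2) h, of u y] p(1) uF False
          by (simp only: length_rev set_rev simp_thms)
      qed
      then show ?thesis using that(1) by blast
    qed
  qed simp
  note closed = this
  have "y \<in> set p \<union> A" if "(u, y) \<in> (parcs G)\<^sup>*" "u \<in> set p \<union> A" for u y
    using that
  proof (induction rule: rtrancl_induct)
    case (step y z)
    then show ?case using closed[of y z] by simp
  qed
  moreover have "p ! 0 \<in> set p" using p by simp
  moreover have "(p ! 0, v) \<in> (parcs G)\<^sup>*"
    using gp p v by (intro connected_rtrancl[OF G c]) (auto simp: graph_path_def)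
  ultimately show ?thesis using v by (auto simp: A_def)
qed

lemma fork_realizes:
  assumes G: "pair_graph G" and l: "longest_path G p" and p: "length p = Suc m" "18 \<le> m"
    and h: "\<not> heavy G" and w: "w \<notin> set p" "(w, p ! 1) \<in> parcs G" and V: "pverts G = insert w (set p)"
  shows "realizes G (m + 2) (fork_rel m)"
  unfolding realizes_def using attached_arcs[OF G l p h w] w(1) l p V
  by (intro exI[of _ "p @ [w]"]) (auto simp: longest_path_def graph_path_def)

text \<open>\<open>R\<close> is \<open>L\<close> for the reversed path, and each has at most one
  element. Which of them are empty decides between the forks and the rest, and if both are empty,
  the edge between the two ends decides between cycle and path.\<close>

lemma classification:
  assumes G: "pair_graph G" and c: "Digraph_Component.connected (with_proj G)"
    and l: "longest_path G p" and p: "length p = Suc m" "18 \<le> m" and h: "\<not> heavy G"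
  shows "realizes G (m + 1) path_rel \<or> realizes G (m + 1) (cycle_rel m) \<or>
    realizes G (m + 2) (fork_rel m) \<or> realizes G (m + 3) (double_fork_rel m)"
proof -
  have gp: "graph_path G p" using l by (simp add: longest_path_def)
  then have dist: "distinct p" and sub: "set p \<subseteq> pverts G" by (simp_all add: graph_path_def)
  note lr = longest_path_rev[OF G l]
  have rp: "length (rev p) = Suc m" using p by simp
  have rev1: "rev p ! 1 = p ! (m - 1)" "rev p ! (m - 1) = p ! 1" using p by (simp_all add: rev_nth)
  define L where "L = {w. w \<notin> set p \<and> (w, p ! 1) \<in> parcs G}"
  define R where "R = {w. w \<notin> set p \<and> (w, rev p ! 1) \<in> parcs G}"
  have V: "pverts G = set p \<union> L \<union> R"
    using spanned_vertices[OF G c l p h] sub pair_graph_verts(1)[OF G] unfolding L_def R_def rev1(1) by blast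
  have L1: "L = {w}" if "w \<in> L" for w
    using attached_vertex(2)[OF G l p h, of w] that by (auto simp: L_def)
  have R1: "R = {w}" if "w \<in> R" for w
    using attached_vertex(2)[OF G lr rp p(2) h, of w] that by (auto simp: R_def)
  consider "L = {}" "R = {}" | w where "L = {w}" "R = {}" | w where "L = {}" "R = {w}"
    | w y where "L = {w}" "R = {y}"
    using L1 R1 by blast
  then show ?thesis
  proof cases
    case 1
    have arcs: "(p ! i, p ! j) \<in> parcs G \<longleftrightarrow>
        (if (p ! 0, p ! m) \<in> parcs G then cycle_rel m i j else path_rel i j)" if "i \<le> m" "j \<le> m" for i j
      unfolding path_arcs[OF G gp p h that] cycle_rel_def path_rel_def by auto
    have "realizes G (m + 1) T" if "\<And>i j. i \<le> m \<Longrightarrow> j \<le> m \<Longrightarrow> (p ! i, p ! j) \<in> parcs G \<longleftrightarrow> T i j" for T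
      unfolding realizes_def
    proof (intro exI[of _ p] conjI)
      show "set p = pverts G" using V 1 by blast
    qed (use dist p(1) that in auto)
    then show ?thesis using arcs by (cases "(p ! 0, p ! m) \<in> parcs G") (simp_all only: if_True if_False, blast+)
  next
    case (2 w)
    then have "w \<notin> set p" "(w, p ! 1) \<in> parcs G" "pverts G = insert w (set p)"
      using V by (auto simp: L_def)
    then show ?thesis using fork_realizes[OF G l p h] by blast
  next
    case (3 w)
    then have "w \<notin> set (rev p)" "(w, rev p ! 1) \<in> parcs G" "pverts G = insert w (set (rev p))"
      using V by (auto simp: R_def)
    then show ?thesis using fork_realizes[OF G lr rp p(2) h] by blast
  next
    case (4 w y)
    then have w: "w \<notin> set p" "(w, p ! 1) \<in> parcs G" and y: "y \<notin> set p" "(y, rev p ! 1) \<in> parcs G"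
      by (auto simp: L_def R_def)
    have y': "y \<notin> set (rev p)" using y by simp
    note A = attached_vertex[OF G l p h w] and B = attached_vertex[OF G lr rp p(2) h y' y(2)]
    have "w \<noteq> y" using A(3) y(2) rev1 by auto
    have yp: "(y, p ! a) \<in> parcs G \<longleftrightarrow> a = m - 1" if "a \<le> m" for a
      using off_path_neighbour[OF G l p h y(1) _ that] B(3) y(2) rev1 by auto
    have py: "(p ! a, y) \<in> parcs G \<longleftrightarrow> a = m - 1" if "a \<le> m" for a
      using that yp pair_graph_symmetric[OF G] by blast
    have wy: "(w, y) \<notin> parcs G" "(y, w) \<notin> parcs G" "(y, y) \<notin> parcs G"
      using A(1)[OF y(1)] B(1)[of w] B(1)[of y] w y by auto
    have nth1: "(p @ [w, y]) ! i = (p @ [w]) ! i" if "i \<le> m + 1" for i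
      using that p by (auto simp: nth_append nth_Cons split: nat.split)
    have nth2: "(p @ [w, y]) ! (m + 2) = y" using p by (simp add: nth_append)
    have nth3: "(p @ [w]) ! a = (if a = m + 1 then w else p ! a)" if "a \<le> m + 1" for a
      using that p by (auto simp: nth_append)
    have row: "(y, (p @ [w]) ! a) \<in> parcs G \<longleftrightarrow> a = m - 1" "((p @ [w]) ! a, y) \<in> parcs G \<longleftrightarrow> a = m - 1"
      if "a \<le> m + 1" for a
      using that yp[of a] py[of a] wy p(2) by (auto simp: nth3)
    have "((p @ [w, y]) ! i, (p @ [w, y]) ! j) \<in> parcs G \<longleftrightarrow> double_fork_rel m i j"
      if ij: "i < m + 3" "j < m + 3" for i j
    proof -
      consider "i \<le> m + 1" "j \<le> m + 1" | "i = m + 2" "j \<le> m + 1" | "i \<le> m + 1" "j = m + 2"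
        | "i = m + 2" "j = m + 2" using ij by linarith
      then show ?thesis
      proof cases
        case 1
        then show ?thesis
          unfolding nth1[OF 1(1)] nth1[OF 1(2)] attached_arcs[OF G l p h w 1]
          by (auto simp: double_fork_rel_def)
      next
        case 2
        then show ?thesis
          unfolding 2(1) nth2 nth1[OF 2(2)] row(1)[OF 2(2)]
          using p(2) by (auto simp: double_fork_rel_def fork_rel_def path_rel_def)
      next
        case 3
        then show ?thesis
          unfolding 3(2) nth2 nth1[OF 3(1)] row(2)[OF 3(1)]
          using p(2) by (auto simp: double_fork_rel_def fork_rel_def path_rel_def)
      next
        case 4
        then show ?thesis
          unfolding 4 nth2 using wy(3) p(2) by (auto simp: double_fork_rel_def fork_rel_def path_rel_def)
      qed
    qed
    then have "realizes G (m + 3) (double_fork_rel m)"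
      unfolding realizes_def using V 4 dist w y \<open>w \<noteq> y\<close> p by (intro exI[of _ "p @ [w, y]"]) auto
    then show ?thesis by blast
  qed
qed

section \<open>Forks and cycles\<close>

text \<open>A cosine wave with its maximum at the doubled end: the two leaves share the value cos 0
  equally, so vertex 1 receives the whole of it, and each leaf has a neighbour of value cos
  \<theta>. The angles make the wave vanish at m + 1, just beyond the other end. Comparing angles
  with those of the path, term by term, amounts to 4 t + 1 < m.\<close>

lemma eigenvalue_sum_fork:
  assumes G: "pair_graph G" and T: "realizes G (m + 2) (fork_rel m)" and k: "1 \<le> k" "4 * k \<le> m" "2 \<le> m"
  shows "eigenvalue_sum k (path_graph (m + 2)) < eigenvalue_sum k G"
proof -
  define \<theta> where "\<theta> t = (2 * real t + 1) * pi / (2 * (real m + 1))" for t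
  define f where "f t a = (if a = 0 \<or> a = m + 1 then 1 / 2 else cos (real a * \<theta> t))" for t a
  have \<theta>: "0 \<le> \<theta> t" for t by (simp add: \<theta>_def)
  have less: "\<theta> t < real (Suc t) * pi / (real (m + 2) + 1)"
    "real (Suc t) * pi / (real (m + 2) + 1) \<le> pi" if "t < k" for t
  proof -
    have "4 * t + 1 < m" using that k by simp
    then have "real (4 * t + 1) < real m" by (simp only: of_nat_less_iff)
    then have "(2 * real t + 1) * (real m + 3) < 2 * (real t + 1) * (real m + 1)"
      by (simp add: algebra_simps)
    then have "(2 * real t + 1) / (2 * (real m + 1)) < (real t + 1) / (real m + 3)"
      by (simp add: divide_simps) (simp add: algebra_simps)
    then have "(2 * real t + 1) / (2 * (real m + 1)) * pi < (real t + 1) / (real m + 3) * pi"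
      by (rule mult_strict_right_mono) simp
    then show "\<theta> t < real (Suc t) * pi / (real (m + 2) + 1)"
      by (simp add: \<theta>_def add_ac)
    have "(real t + 1) * pi \<le> (real m + 3) * pi" using that k by (intro mult_right_mono) auto
    then show "real (Suc t) * pi / (real (m + 2) + 1) \<le> pi"
      by (simp add: pos_divide_le_eq algebra_simps)
  qed
  have "(\<Sum>t<k. 2 * cos (\<theta> t)) \<le> eigenvalue_sum k G"
  proof (rule eigenvalue_sum_ge_eigenvectors[OF G T, where f = f])
    fix t a assume t: "t < k" and a: "a < m + 2"
    have c3: "cos (real (Suc b) * \<theta> t) + cos (real (b - 1) * \<theta> t) = 2 * cos (\<theta> t) * cos (real b * \<theta> t)"
      if "1 \<le> b" for b
      using cos_three_term[of "real b" "\<theta> t"] that by (simp add: of_nat_diff add.commute)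
    have "real (Suc m) * \<theta> t = real (Suc (2 * t)) * (pi / 2)"
      unfolding \<theta>_def by (simp add: divide_simps) (simp add: algebra_simps)
    then have "\<exists>l. odd l \<and> real (Suc m) * \<theta> t = real l * (pi / 2)"
      by (intro exI[of _ "Suc (2 * t)"]) simp
    then have end0: "cos (real (Suc m) * \<theta> t) = 0" unfolding cos_zero_iff by blast
    have mid: "f t b = cos (real b * \<theta> t)" if "1 \<le> b" "b \<le> m" for b
      using that by (simp add: f_def)
    consider "a = 0 \<or> a = m + 1" | "a = 1" | "2 \<le> a" "a < m" | "a = m" "2 \<le> a" using a k(3) by linarith
    then have "sum (f t) {b \<in> {..<m + 2}. fork_rel m a b} = 2 * cos (\<theta> t) * f t a"
    proof cases
      case 1
      then have "{b \<in> {..<m + 2}. fork_rel m a b} = {1}" using k(3) by (auto simp: fork_rel_def path_rel_def)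
      then show ?thesis using 1 k(3) by (auto simp: f_def)
    next
      case 2
      then have "{b \<in> {..<m + 2}. fork_rel m a b} = {0, 2, m + 1}" using k(3) by (auto simp: fork_rel_def path_rel_def)
      then show ?thesis using 2 k(3) c3[of 1] by (auto simp: f_def numeral_2_eq_2)
    next
      case 3
      then have "{b \<in> {..<m + 2}. fork_rel m a b} = {a - 1, Suc a}" using k(3) by (auto simp: fork_rel_def path_rel_def)
      moreover have "sum (f t) {a - 1, Suc a} = f t (a - 1) + f t (Suc a)"
      proof -
        have "a - 1 \<noteq> Suc a" by arith
        then show ?thesis by simp
      qed
      moreover have "f t (a - 1) = cos (real (a - 1) * \<theta> t)" "f t (Suc a) = cos (real (Suc a) * \<theta> t)"
        "f t a = cos (real a * \<theta> t)"
        using 3 by (intro mid; linarith)+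
      ultimately show ?thesis using 3(1) c3[of a] by simp
    next
      case 4
      then have "{b \<in> {..<m + 2}. fork_rel m a b} = {a - 1}" using k(3) by (auto simp: fork_rel_def path_rel_def)
      moreover have "f t (a - 1) = cos (real (a - 1) * \<theta> t)" "f t a = cos (real a * \<theta> t)"
        using 4 by (intro mid; linarith)+
      ultimately show ?thesis using 4 c3[of a] end0 by simp
    qed
    then show "(\<Sum>b<m + 2. if fork_rel m a b then f t b else 0) = 2 * cos (\<theta> t) * f t a"
      by (simp only: sum.inter_filter[OF finite_lessThan])
  next
    fix t assume "t < k"
    then show "\<exists>a<m + 2. f t a \<noteq> 0" by (intro exI[of _ 0]) (simp add: f_def)
  next
    fix s t assume st: "s < t" "t < k" "2 * cos (\<theta> s) = 2 * cos (\<theta> t)"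
    then have "\<theta> s < \<theta> t" by (simp add: \<theta>_def divide_strict_right_mono)
    moreover have "\<theta> t \<le> pi" using less[OF st(2)] by simp
    ultimately have "cos (\<theta> t) < cos (\<theta> s)" using \<theta> by (intro cos_monotone_0_pi) auto
    then show "(\<Sum>a<m + 2. f s a * f t a) = 0" using st by simp
  qed
  moreover have "(\<Sum>t<k. 2 * cos (real (Suc t) * pi / (real (m + 2) + 1))) < (\<Sum>t<k. 2 * cos (\<theta> t))"
  proof (rule sum_strict_mono)
    fix t assume "t \<in> {..<k}"
    then show "2 * cos (real (Suc t) * pi / (real (m + 2) + 1)) < 2 * cos (\<theta> t)"
      using less[of t] \<theta>[of t] cos_monotone_0_pi[of "\<theta> t"] by simp
  qed (use k in \<open>auto simp: lessThan_empty_iff\<close>)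
  ultimately show ?thesis using eigenvalue_sum_path_graph[of k "m + 2"] k by simp
qed

text \<open>With both ends doubled the wave must have an extremum at m too, which forces the angles
  t * pi / m; its value there is split equally between \<open>m\<close> and \<open>m + 2\<close>.
  The first eigenvalue is then 2, and the comparison of angles amounts to 4 t < m.\<close>

lemma eigenvalue_sum_double_fork:
  assumes G: "pair_graph G" and T: "realizes G (m + 3) (double_fork_rel m)" and k: "1 \<le> k" "4 * k \<le> m" "4 \<le> m"
  shows "eigenvalue_sum k (path_graph (m + 3)) < eigenvalue_sum k G"
proof -
  define \<theta> where "\<theta> t = real t * pi / real m" for t
  define f where "f t a = (if a = 0 \<or> a = m + 1 then 1 / 2 else
    if a = m \<or> a = m + 2 then cos (real m * \<theta> t) / 2 else cos (real a * \<theta> t))" for t a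
  have \<theta>: "0 \<le> \<theta> t" for t by (simp add: \<theta>_def)
  have less: "\<theta> t < real (Suc t) * pi / (real (m + 3) + 1)"
    "real (Suc t) * pi / (real (m + 3) + 1) \<le> pi" if "t < k" for t
  proof -
    have "4 * real t < real m" using that k by simp
    then have "real t * (real m + 4) < (real t + 1) * real m" by (simp add: algebra_simps)
    then have "real t / real m < (real t + 1) / (real m + 4)"
      using k by (simp add: divide_simps)
    then have "real t / real m * pi < (real t + 1) / (real m + 4) * pi"
      by (rule mult_strict_right_mono) simp
    then show "\<theta> t < real (Suc t) * pi / (real (m + 3) + 1)"
      by (simp add: \<theta>_def add_ac)
    have "(real t + 1) * pi \<le> (real m + 4) * pi" using that k by (intro mult_right_mono) auto
    then show "real (Suc t) * pi / (real (m + 3) + 1) \<le> pi"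
      by (simp add: pos_divide_le_eq algebra_simps)
  qed
  have "(\<Sum>t<k. 2 * cos (\<theta> t)) \<le> eigenvalue_sum k G"
  proof (rule eigenvalue_sum_ge_eigenvectors[OF G T, where f = f])
    fix t a assume t: "t < k" and a: "a < m + 3"
    have c3: "cos (real (Suc b) * \<theta> t) + cos (real (b - 1) * \<theta> t) = 2 * cos (\<theta> t) * cos (real b * \<theta> t)"
      if "1 \<le> b" for b
      using cos_three_term[of "real b" "\<theta> t"] that by (simp add: of_nat_diff add.commute)
    have "real m * \<theta> t = real t * pi" using k by (simp add: \<theta>_def)
    then have "sin (real m * \<theta> t) = 0" by (simp only: sin_npi)
    then have "cos (real (m - 1) * \<theta> t) = cos (\<theta> t) * cos (real m * \<theta> t)"
      using k by (simp add: of_nat_diff left_diff_distrib cos_diff)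
    then have end0: "cos (real (m - 1) * \<theta> t) = 2 * cos (\<theta> t) * (cos (real m * \<theta> t) / 2)" by simp
    have mid: "f t b = cos (real b * \<theta> t)" if "1 \<le> b" "b + 1 \<le> m" for b
      using that by (simp add: f_def)
    consider "a = 0 \<or> a = m + 1" | "a = 1" | "2 \<le> a" "a < m - 1" | "a = m - 1" | "a = m \<or> a = m + 2"
      using a k(3) by linarith
    then have "sum (f t) {b \<in> {..<m + 3}. double_fork_rel m a b} = 2 * cos (\<theta> t) * f t a"
    proof cases
      case 1
      then have "{b \<in> {..<m + 3}. double_fork_rel m a b} = {1}" using k(3)
        by (auto simp: double_fork_rel_def fork_rel_def path_rel_def)
      then show ?thesis using 1 k(3) by (auto simp: f_def)
    next
      case 2
      then have "{b \<in> {..<m + 3}. double_fork_rel m a b} = {0, 2, m + 1}" using k(3)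
        by (auto simp: double_fork_rel_def fork_rel_def path_rel_def)
      then show ?thesis using 2 k(3) c3[of 1] by (auto simp: f_def numeral_2_eq_2)
    next
      case 3
      then have "{b \<in> {..<m + 3}. double_fork_rel m a b} = {a - 1, Suc a}" using k(3)
        by (auto simp: double_fork_rel_def fork_rel_def path_rel_def)
      moreover have "sum (f t) {a - 1, Suc a} = f t (a - 1) + f t (Suc a)"
      proof -
        have "a - 1 \<noteq> Suc a" by arith
        then show ?thesis by simp
      qed
      moreover have "f t (a - 1) = cos (real (a - 1) * \<theta> t)" "f t (Suc a) = cos (real (Suc a) * \<theta> t)"
        "f t a = cos (real a * \<theta> t)"
        using 3 by (intro mid; linarith)+
      ultimately show ?thesis using 3(1) c3[of a] by simp
    next
      case 4
      \<comment> \<open>Substituting for \<open>m\<close> removes the truncated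
        subtractions.\<close>
      obtain l where "m = l + 4" using k(3) by (metis add.commute le_Suc_ex)
      with 4 have "{b \<in> {..<m + 3}. double_fork_rel m a b} = {m - 2, m, m + 2}"
        by (auto simp: double_fork_rel_def fork_rel_def path_rel_def)
      moreover have "sum (f t) {m - 2, m, m + 2} = f t (m - 2) + (f t m + f t (m + 2))"
      proof -
        have "m - 2 \<noteq> m" "m - 2 \<noteq> m + 2" "m \<noteq> m + 2" using k(3) by arith+
        then show ?thesis by simp
      qed
      moreover have "f t (m - 2) = cos (real (m - 2) * \<theta> t)" "f t m = cos (real m * \<theta> t) / 2"
        "f t (m + 2) = cos (real m * \<theta> t) / 2" "f t (m - 1) = cos (real (m - 1) * \<theta> t)"
        using k(3) by (auto simp: f_def)
      moreover have "cos (real m * \<theta> t) + cos (real (m - 2) * \<theta> t) = 2 * cos (\<theta> t) * cos (real (m - 1) * \<theta> t)"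
      proof -
        have "m - 1 - 1 = m - 2" "Suc (m - 1) = m" "1 \<le> m - 1" using k(3) by auto
        then show ?thesis using c3[of "m - 1"] by (simp only:)
      qed
      ultimately show ?thesis using 4 by simp
    next
      case 5
      then have "{b \<in> {..<m + 3}. double_fork_rel m a b} = {m - 1}" using k(3)
        by (auto simp: double_fork_rel_def fork_rel_def path_rel_def)
      moreover have "f t a = cos (real m * \<theta> t) / 2" using 5 k(3) by (auto simp: f_def)
      moreover have "f t (m - 1) = cos (real (m - 1) * \<theta> t)" using k(3) by (auto simp: f_def)
      ultimately show ?thesis using end0 by simp
    qed
    then show "(\<Sum>b<m + 3. if double_fork_rel m a b then f t b else 0) = 2 * cos (\<theta> t) * f t a"
      by (simp only: sum.inter_filter[OF finite_lessThan])
  next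
    fix t assume "t < k"
    then show "\<exists>a<m + 3. f t a \<noteq> 0" by (intro exI[of _ 0]) (simp add: f_def)
  next
    fix s t assume st: "s < t" "t < k" "2 * cos (\<theta> s) = 2 * cos (\<theta> t)"
    then have "\<theta> s < \<theta> t" using k by (simp add: \<theta>_def divide_strict_right_mono)
    moreover have "\<theta> t \<le> pi" using less[OF st(2)] by simp
    ultimately have "cos (\<theta> t) < cos (\<theta> s)" using \<theta> by (intro cos_monotone_0_pi) auto
    then show "(\<Sum>a<m + 3. f s a * f t a) = 0" using st by simp
  qed
  moreover have "(\<Sum>t<k. 2 * cos (real (Suc t) * pi / (real (m + 3) + 1))) < (\<Sum>t<k. 2 * cos (\<theta> t))"
  proof (rule sum_strict_mono)
    fix t assume "t \<in> {..<k}"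
    then show "2 * cos (real (Suc t) * pi / (real (m + 3) + 1)) < 2 * cos (\<theta> t)"
      using less[of t] \<theta>[of t] cos_monotone_0_pi[of "\<theta> t"] by simp
  qed (use k in \<open>auto simp: lessThan_empty_iff\<close>)
  ultimately show ?thesis using eigenvalue_sum_path_graph[of k "m + 3"] k by simp
qed

section \<open>Cycles\<close>

lemma cos_2pi_nat: "cos (2 * pi * real j) = 1" "sin (2 * pi * real j) = 0"
  using cos_2npi[of j] sin_2npi[of j] by (simp_all add: mult_ac)

lemma half_le_sin:
  fixes x :: real
  assumes "0 \<le> x" "x \<le> pi / 3"
  shows "x / 2 \<le> sin x"
proof (cases "x = 0")
  case False
  then obtain z where z: "0 < z" "z < x" "sin x - sin 0 = (x - 0) * cos z"
    using MVT2[of 0 x sin cos] assms by auto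
  have "cos (pi / 3) \<le> cos z" using z assms pi_gt_zero by (intro cos_monotone_0_pi_le) auto
  then have "x * (1 / 2) \<le> x * cos z" using assms by (intro mult_left_mono) (simp_all add: cos_60)
  then show ?thesis using z by simp
qed simp

lemma cos_diff_le:
  fixes x y :: real
  assumes "0 \<le> y" "y \<le> x"
  shows "cos y - cos x \<le> (x\<^sup>2 - y\<^sup>2) / 2"
proof -
  have "sin ((y + x) / 2) * sin ((x - y) / 2) \<le> \<bar>sin ((y + x) / 2)\<bar> * \<bar>sin ((x - y) / 2)\<bar>"
    by (simp flip: abs_mult)
  also have "\<dots> \<le> \<bar>(y + x) / 2\<bar> * \<bar>(x - y) / 2\<bar>"
    by (intro mult_mono abs_sin_x_le_abs_x) auto
  also have "\<dots> = (x\<^sup>2 - y\<^sup>2) / 4" using assms by (simp add: power2_eq_square field_simps)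
  finally show ?thesis by (simp add: cos_diff_cos)
qed

text \<open>The comparison fails term by term: for odd \<open>t\<close> the angle (t + 1) pi / n of
  the cycle slightly exceeds the angle (t + 1) pi / (n + 1) of the path. Each term loses at most 3
  k^2 \<psi>^2 / n, while the first gains at least \<psi>^2 / 4, because the cycle has the
  eigenvalue 2. The cubic bound on \<open>m\<close> lets this one gain outweigh all losses.\<close>

lemma eigenvalue_sum_cycle:
  assumes G: "pair_graph G" and T: "realizes G (m + 1) (cycle_rel m)" and k: "1 \<le> k" "12 * k ^ 3 \<le> m" "4 * k \<le> m"
  shows "eigenvalue_sum k (path_graph (m + 1)) < eigenvalue_sum k G"
proof -
  define n where "n = m + 1"
  have m3: "3 \<le> m" using k by simp
  \<comment> \<open>(t + 1) div 2 runs through 0, 1, 1, 2, 2, and so on: every positive frequency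
    occurs twice, with a sine for odd and a cosine for even \<open>t\<close>.\<close>
  define \<phi> where "\<phi> t = 2 * pi * real ((t + 1) div 2) / real n" for t
  define f where "f t a = (if even t then cos (real a * \<phi> t) else sin (real a * \<phi> t))" for t a
  have \<phi>: "0 \<le> \<phi> t" for t by (simp add: \<phi>_def)
  have \<phi>_pi: "\<phi> t < pi" if "t < k" for t
  proof -
    have "2 * ((t + 1) div 2) < n" using that k by (simp add: n_def)
    then have "real (2 * ((t + 1) div 2)) < real n" by (simp only: of_nat_less_iff)
    then have "2 * real ((t + 1) div 2) < real n" by simp
    then have "pi * (2 * real ((t + 1) div 2)) < pi * real n" by (intro mult_strict_left_mono) auto
    then show ?thesis by (simp add: \<phi>_def n_def pos_divide_less_eq mult_ac)
  qed
  have period: "real n * \<phi> t = 2 * pi * real ((t + 1) div 2)" for t by (simp add: \<phi>_def n_def)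
  have "(\<Sum>t<k. 2 * cos (\<phi> t)) \<le> eigenvalue_sum k G"
  proof (rule eigenvalue_sum_ge_eigenvectors[OF G T, where f = f])
    fix t a assume t: "t < k" and a: "a < m + 1"
    define h where "h x = (if even t then cos (x * \<phi> t) else sin (x * \<phi> t))" for x
    have fh: "f t b = h (real b)" for b by (simp add: f_def h_def)
    have h3: "h (x + 1) + h (x - 1) = 2 * cos (\<phi> t) * h x" for x
      using cos_three_term[of x "\<phi> t"] sin_three_term[of x "\<phi> t"] by (simp add: h_def)
    have hp: "h (x + real n) = h x" for x
    proof -
      have "(x + real n) * \<phi> t = x * \<phi> t + 2 * pi * real ((t + 1) div 2)"
        by (simp add: distrib_right period)
      moreover have "cos (y + 2 * pi * real j) = cos y" "sin (y + 2 * pi * real j) = sin y" for y j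
        by (simp_all add: sin_add cos_add cos_2pi_nat)
      ultimately show ?thesis by (simp only: h_def)
    qed
    have hm: "h (real m) = h (- 1)" using hp[of "- 1"] by (simp add: n_def)
    have hm1: "h (real m + 1) = h 0" using hp[of 0] by (simp add: n_def add.commute)
    consider "a = 0" | "1 \<le> a" "a < m" | "a = m" using a by linarith
    then have "sum (f t) {b \<in> {..<m + 1}. cycle_rel m a b} = 2 * cos (\<phi> t) * f t a"
    proof cases
      case 1
      then have "{b \<in> {..<m + 1}. cycle_rel m a b} = {1, m}" using m3 by (auto simp: cycle_rel_def path_rel_def)
      then show ?thesis using 1 m3 h3[of 0] hm by (simp add: fh)
    next
      case 2
      then have "{b \<in> {..<m + 1}. cycle_rel m a b} = {a - 1, Suc a}" by (auto simp: cycle_rel_def path_rel_def)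
      then show ?thesis using 2 h3[of "real a"] by (simp add: fh of_nat_diff add.commute)
    next
      case 3
      then have "{b \<in> {..<m + 1}. cycle_rel m a b} = {m - 1, 0}" using m3 by (auto simp: cycle_rel_def path_rel_def)
      then show ?thesis using 3 m3 h3[of "real m"] hm1 by (simp add: fh of_nat_diff add.commute)
    qed
    then show "(\<Sum>b<m + 1. if cycle_rel m a b then f t b else 0) = 2 * cos (\<phi> t) * f t a"
      by (simp only: sum.inter_filter[OF finite_lessThan])
  next
    fix t assume t: "t < k"
    show "\<exists>a<m + 1. f t a \<noteq> 0"
    proof (cases "even t")
      case True
      then show ?thesis by (intro exI[of _ 0]) (simp add: f_def)
    next
      case False
      then have "0 < \<phi> t" by (auto simp: \<phi>_def n_def elim!: oddE intro!: divide_pos_pos)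
      then have "0 < sin (\<phi> t)" using \<phi>_pi[OF t] by (rule sin_gt_zero)
      then show ?thesis using False m3 by (intro exI[of _ 1]) (simp add: f_def)
    qed
  next
    fix s t assume st: "s < t" "t < k" "2 * cos (\<phi> s) = 2 * cos (\<phi> t)"
    have "\<phi> s \<le> pi" "\<phi> t \<le> pi" "cos (\<phi> s) = cos (\<phi> t)"
      using \<phi>_pi[of s] \<phi>_pi[of t] st by simp_all
    then have "\<phi> s = \<phi> t" by (intro cos_inj_pi[OF \<phi> _ \<phi>])
    then have "(s + 1) div 2 = (t + 1) div 2" by (simp add: \<phi>_def n_def)
    \<comment> \<open>A coincidence is possible only between the sine and the cosine of one
      frequency.\<close>
    then have "odd s" "even t" "0 < (t + 1) div 2" using st(1) by presburger+
    then have "0 < \<phi> t" by (auto simp: \<phi>_def n_def intro!: divide_pos_pos)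
    then have "0 < sin (\<phi> t)" using \<phi>_pi[OF st(2)] by (rule sin_gt_zero)
    \<comment> \<open>The factor 4 sin \<phi> makes the sum telescope, and the two boundary terms
      agree because n vertices cover whole periods.\<close>
    have "4 * sin (\<phi> t) * (\<Sum>a<n. f s a * f t a)
        = (\<Sum>a<n. cos ((2 * real a - 1) * \<phi> t) - cos ((2 * real (Suc a) - 1) * \<phi> t))"
      unfolding sum_distrib_left
    proof (rule sum.cong[OF refl])
      fix a :: nat
      have "cos ((2 * real a - 1) * \<phi> t) - cos ((2 * real (Suc a) - 1) * \<phi> t)
          = cos (2 * (real a * \<phi> t) - \<phi> t) - cos (2 * (real a * \<phi> t) + \<phi> t)"
        by (simp add: algebra_simps)
      also have "\<dots> = 2 * sin (2 * (real a * \<phi> t)) * sin (\<phi> t)" by (simp add: cos_diff cos_add)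
      also have "\<dots> = 4 * sin (\<phi> t) * (sin (real a * \<phi> t) * cos (real a * \<phi> t))"
        by (simp only: sin_double) simp
      finally show "4 * sin (\<phi> t) * (f s a * f t a)
          = cos ((2 * real a - 1) * \<phi> t) - cos ((2 * real (Suc a) - 1) * \<phi> t)"
        using \<open>odd s\<close> \<open>even t\<close> \<open>\<phi> s = \<phi> t\<close> by (simp add: f_def)
    qed
    also have "\<dots> = cos (- \<phi> t) - cos ((2 * real n - 1) * \<phi> t)"
      by (subst sum_lessThan_telescope') simp
    also have "(2 * real n - 1) * \<phi> t = 2 * pi * real (2 * ((t + 1) div 2)) - \<phi> t"
      using period[of t] by (simp add: algebra_simps)
    also have "cos \<dots> = cos (\<phi> t)" by (simp only: cos_diff cos_2pi_nat mult_1 mult_zero_left add_0_right)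
    finally show "(\<Sum>a<m + 1. f s a * f t a) = 0" using \<open>0 < sin (\<phi> t)\<close> by (simp add: n_def)
  qed
  moreover have "(\<Sum>t<k. 2 * cos (real (Suc t) * pi / (real n + 1))) < (\<Sum>t<k. 2 * cos (\<phi> t))"
  proof -
    define \<psi> where "\<psi> = pi / (real n + 1)"
    have \<psi>: "0 < \<psi>" "\<psi> \<le> pi / 3" using m3 by (auto simp: \<psi>_def n_def field_simps intro!: add_pos_nonneg)
    have first: "\<psi>\<^sup>2 / 4 \<le> 2 * cos (\<phi> 0) - 2 * cos \<psi>"
    proof -
      have "(\<psi> / 2) / 2 \<le> sin (\<psi> / 2)" using \<psi> by (intro half_le_sin) auto
      then have "((\<psi> / 2) / 2)\<^sup>2 \<le> (sin (\<psi> / 2))\<^sup>2" using \<psi> by (intro power_mono) auto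
      moreover have "cos \<psi> = 1 - 2 * (sin (\<psi> / 2))\<^sup>2"
        using cos_double_sin[of "\<psi> / 2"] by simp
      ultimately show ?thesis by (simp add: \<phi>_def power_divide)
    qed
    have rest: "- (3 * (real k)\<^sup>2 * \<psi>\<^sup>2 / real n) \<le> 2 * cos (\<phi> t) - 2 * cos (real (Suc t) * \<psi>)" if t: "t < k" for t
    proof (cases "\<phi> t \<le> real (Suc t) * \<psi>")
      case True
      have "real (Suc t) * pi \<le> (real n + 1) * pi" using t k by (intro mult_right_mono) (auto simp: n_def)
      then have "real (Suc t) * \<psi> \<le> pi" by (simp add: \<psi>_def field_simps)
      then have "cos (real (Suc t) * \<psi>) \<le> cos (\<phi> t)"
        using True \<phi>[of t] by (intro cos_monotone_0_pi_le)
      moreover have "0 \<le> 3 * (real k)\<^sup>2 * \<psi>\<^sup>2 / real n" by simp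
      ultimately show ?thesis by linarith
    next
      case False
      \<comment> \<open>\<open>x\<close> bounds \<phi> t from above, with equality for odd
        \<open>t\<close>. It is the angle of the path stretched by (n + 1) / n, so the squares
        differ by a relative error of at most 3 / n.\<close>
      define x where "x = real (Suc t) * pi / real n"
      have "2 * real ((t + 1) div 2) \<le> real (Suc t)" by linarith
      then have "2 * real ((t + 1) div 2) * pi / real n \<le> x"
        unfolding x_def by (intro divide_right_mono mult_right_mono) auto
      then have \<phi>x: "\<phi> t \<le> x" by (simp add: \<phi>_def mult_ac)
      have "cos (real (Suc t) * \<psi>) - cos (\<phi> t) \<le> ((\<phi> t)\<^sup>2 - (real (Suc t) * \<psi>)\<^sup>2) / 2"
        using False \<psi> by (intro cos_diff_le) auto
      also have "\<dots> \<le> (x\<^sup>2 - (real (Suc t) * \<psi>)\<^sup>2) / 2"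
        using \<phi>x \<phi>[of t] by (simp add: power_mono)
      finally have 1: "2 * cos (real (Suc t) * \<psi>) - 2 * cos (\<phi> t) \<le> x\<^sup>2 - (real (Suc t) * \<psi>)\<^sup>2" by simp
      have xs: "x = real (Suc t) * \<psi> * ((real n + 1) / real n)" by (simp add: x_def \<psi>_def)
      have "x\<^sup>2 - (real (Suc t) * \<psi>)\<^sup>2 = (real (Suc t))\<^sup>2 * \<psi>\<^sup>2 * (((real n + 1) / real n)\<^sup>2 - 1)"
        by (simp only: xs power_mult_distrib right_diff_distrib mult_1_right)
      also have "\<dots> \<le> (real k)\<^sup>2 * \<psi>\<^sup>2 * (3 / real n)"
      proof (intro mult_mono)
        have n1: "1 \<le> real n" by (simp add: n_def)
        have "((real n + 1) / real n)\<^sup>2 - 1 = 2 / real n + 1 / (real n * real n)"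
          using n1 by (simp add: field_simps power2_eq_square)
        also have "1 / (real n * real n) \<le> 1 / real n"
          using n1 by (intro divide_left_mono) auto
        finally show "((real n + 1) / real n)\<^sup>2 - 1 \<le> 3 / real n" by simp
        show "0 \<le> ((real n + 1) / real n)\<^sup>2 - 1" using n1 by (simp add: field_simps power2_eq_square)
        show "(real (Suc t))\<^sup>2 \<le> (real k)\<^sup>2" using t by (intro power_mono) auto
      qed auto
      finally show ?thesis using 1 by (simp add: mult_ac)
    qed
    obtain l where l: "k = Suc l" using k(1) by (cases k) auto
    have "(\<Sum>t<k. 2 * cos (\<phi> t) - 2 * cos (real (Suc t) * \<psi>))
        = (2 * cos (\<phi> 0) - 2 * cos \<psi>) + (\<Sum>t<l. 2 * cos (\<phi> (Suc t)) - 2 * cos (real (Suc (Suc t)) * \<psi>))"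
      unfolding l by (subst sum.lessThan_Suc_shift) simp
    moreover have "(\<Sum>t<l. - (3 * (real k)\<^sup>2 * \<psi>\<^sup>2 / real n))
        \<le> (\<Sum>t<l. 2 * cos (\<phi> (Suc t)) - 2 * cos (real (Suc (Suc t)) * \<psi>))"
      by (intro sum_mono rest) (auto simp: l)
    moreover have "real l * (3 * (real k)\<^sup>2 * \<psi>\<^sup>2 / real n) < \<psi>\<^sup>2 / 4"
    proof -
      have "real (12 * k ^ 3) \<le> real m" using k(2) by (simp only: of_nat_le_iff)
      then have "12 * real k ^ 3 \<le> real m" by simp
      moreover have "real l * (real k)\<^sup>2 \<le> real k ^ 3"
        by (simp add: l power3_eq_cube power2_eq_square mult_right_mono)
      ultimately have "12 * (real l * (real k)\<^sup>2) < real n" by (simp add: n_def)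
      then have "\<psi>\<^sup>2 * (12 * (real l * (real k)\<^sup>2)) < \<psi>\<^sup>2 * real n"
        using \<psi> by (intro mult_strict_left_mono) auto
      then show ?thesis by (simp add: field_simps n_def)
    qed
    ultimately have "0 < (\<Sum>t<k. 2 * cos (\<phi> t) - 2 * cos (real (Suc t) * \<psi>))"
      using first by simp
    then show ?thesis by (simp add: sum_subtractf \<psi>_def)
  qed
  ultimately show ?thesis using eigenvalue_sum_path_graph[of k n] k by (simp add: n_def)
qed

section \<open>The comparison\<close>

lemma realizes_card:
  assumes "realizes G n T" shows "card (pverts G) = n"
  using assms by (metis realizes_def distinct_card)

text \<open>The ceiling gives r + 1 >= pi / x for x = arccos (1 - 0.0097 / (k - 1)); so a path on r
  vertices has largest eigenvalue at least 2 - 2 * 0.0097 / (k - 1). As x < pi, the ceiling is at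
  least 2 and r is positive.\<close>

lemma r_eps_properties:
  assumes "2 \<le> k"
  obtains r where "1 \<le> r" "r_eps 0.0097 k = int r"
    "1 - 0.0097 / real (k - 1) \<le> cos (pi / (real r + 1))"
proof -
  define e where "e = 0.0097 / real (k - 1)"
  have e: "0 < e" "e \<le> 0.0097" using assms by (auto simp: e_def field_simps)
  define x where "x = arccos (1 - e)"
  have x: "0 < x" "x < pi" using arccos_lt_bounded[of "1 - e"] e by (auto simp: x_def)
  define c where "c = \<lceil>pi / x\<rceil>"
  have "1 < pi / x" using x by simp
  then have "2 \<le> c" unfolding c_def by linarith
  have r: "r_eps 0.0097 k = c - 1"
    using assms by (simp add: r_eps_def c_def x_def e_def of_nat_diff)
  define r where "r = nat (c - 1)"
  have rc: "int r = c - 1" "1 \<le> r" using \<open>2 \<le> c\<close> by (auto simp: r_def)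
  then have "real r + 1 = of_int c" by (metis add_diff_cancel_left' diff_add_cancel of_int_1 of_int_add of_int_of_nat_eq)
  then have "pi / x \<le> real r + 1" by (simp add: c_def)
  then have "pi / (real r + 1) \<le> x" using x by (simp add: field_simps)
  then have "cos x \<le> cos (pi / (real r + 1))" using x by (intro cos_monotone_0_pi_le) auto
  then have "1 - e \<le> cos (pi / (real r + 1))" using e by (simp add: x_def cos_arccos)
  then show ?thesis using that[of r] rc r by (simp add: e_def)
qed

text \<open>Halving the angle divides the deficiency \<open>1 - cos\<close> by nearly four.\<close>

lemma half_angle_deficiency:
  assumes "2 \<le> k" "1 \<le> r" and c: "1 - 0.0097 / real (k - 1) \<le> cos (pi / (real r + 1))"
  shows "real (k - 1) * (2 - 2 * cos (pi / (real (2 * r + 1) + 1))) \<le> 0.005"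
proof -
  define e where "e = 0.0097 / real (k - 1)"
  have e: "0 < e" "e \<le> 0.0097" using assms by (auto simp: e_def field_simps)
  define y where "y = pi / (real (2 * r + 1) + 1)"
  define C where "C = cos y"
  have "pi / (real r + 1) = 2 * y" by (simp add: y_def field_simps)
  then have C2: "1 - e \<le> 2 * C\<^sup>2 - 1" using c by (simp add: e_def C_def cos_double_cos)
  have "pi * 1 \<le> pi * (2 * real r + 2) / 2" by simp
  then have "y \<le> pi / 2" by (simp add: y_def field_simps)
  moreover have "0 \<le> y" by (simp add: y_def)
  ultimately have "0 \<le> C" "C \<le> 1" by (auto simp: C_def intro: cos_ge_zero)
  have "C\<^sup>2 \<le> C" using \<open>0 \<le> C\<close> \<open>C \<le> 1\<close> by (simp add: power2_eq_square mult_left_le)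
  \<comment> \<open>A crude bound on \<open>C\<close> that makes the factor 1 + C at least 1.995. A
    factor of 2 would give a total deficiency of 0.00485, so 0.005 leaves enough slack.\<close>
  then have "0.995 \<le> C" using C2 e by simp
  then have "(1 - C) * 1.995 \<le> (1 - C) * (1 + C)" using \<open>C \<le> 1\<close> by (intro mult_left_mono) auto
  also have "\<dots> \<le> e / 2" using C2 by (simp add: power2_eq_square algebra_simps)
  finally have "2 - 2 * C \<le> e / 1.995" by simp
  then have "real (k - 1) * (2 - 2 * C) \<le> real (k - 1) * (e / 1.995)" by (intro mult_left_mono) auto
  also have "\<dots> = 0.0097 / 1.995"
  proof -
    have "real (k - 1) \<noteq> 0" using assms(1) by simp
    then show ?thesis by (simp add: e_def del: of_nat_diff)
  qed
  also have "\<dots> \<le> 0.005" by simp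
  finally show ?thesis by (simp add: C_def y_def)
qed

text \<open>Centre weight 2, close to the square root of 5, gives the excess 2/9, far above the
  deficiency 2 * 0.0097 of the short blocks. The factor k + 5 is k - 1 plus the six vertices of the
  star.\<close>

lemma eigenvalue_sum_ge_degree_5:
  assumes G: "pair_graph G" and x: "x \<in> pverts G" and deg: "5 \<le> card {y. (x, y) \<in> parcs G}"
    and p: "graph_path G p" and k: "2 \<le> k" and r: "1 \<le> r" and len: "(k + 5) * r \<le> length p"
    and c: "1 - 0.0097 / real (k - 1) \<le> cos (pi / (real r + 1))"
  shows "2 * real k \<le> eigenvalue_sum k G"
proof -
  obtain N where N: "N \<subseteq> {y. (x, y) \<in> parcs G}" "card N = 5" "finite N"
    using obtain_subset_with_card_n[OF deg] by blast
  have "carries G (insert x N) (2 + 2 / 9)"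
    using carries_star[OF G x N(3,1), of 2] N(2) by simp
  moreover have "card (insert x N) \<le> 6" using N by (simp add: card_insert_if)
  then have "(k - 1 + card (insert x N)) * r \<le> (k + 5) * r" using k by (intro mult_le_mono1) simp
  then have "(k - 1 + card (insert x N)) * r \<le> length p" using len by (rule order_trans)
  moreover have "real (k - 1) * (2 - 2 * cos (pi / (real r + 1))) \<le> 2 / 9"
  proof -
    have "real (k - 1) * (2 - 2 * cos (pi / (real r + 1))) \<le> real (k - 1) * (2 * (0.0097 / real (k - 1)))"
      using c by (intro mult_left_mono) auto
    also have "\<dots> \<le> 2 / 9"
    proof -
      have "real (k - 1) \<noteq> 0" using k by simp
      then show ?thesis by (simp del: of_nat_diff)
    qed
    finally show ?thesis .
  qed
  ultimately show ?thesis using eigenvalue_sum_ge_heavy[OF G p, of "insert x N" "2 / 9" k r] N k r by simp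
qed

text \<open>An excess of 0.005 calls for half the angle pi / (r + 1), and a path on 2 r + 1 vertices
  has exactly that. The factor k + 9 is k - 1 plus at most ten vertices of the heavy set.\<close>

lemma eigenvalue_sum_ge_if_heavy:
  assumes G: "pair_graph G" and h: "heavy G"
    and p: "graph_path G p" and k: "2 \<le> k" and r: "1 \<le> r" and len: "(k + 9) * (2 * r + 1) \<le> length p"
    and c: "1 - 0.0097 / real (k - 1) \<le> cos (pi / (real r + 1))"
  shows "2 * real k \<le> eigenvalue_sum k G"
proof -
  obtain S where S: "finite S" "card S \<le> 10" "carries G S (2 + 0.005)" using h by (auto simp: heavy_def)
  have "(k - 1 + card S) * (2 * r + 1) \<le> (k + 9) * (2 * r + 1)"
    using S k by (intro mult_le_mono1) simp
  then have "(k - 1 + card S) * (2 * r + 1) \<le> length p" using len by simp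
  then show ?thesis
    using eigenvalue_sum_ge_heavy[OF G p S(1,3), of k "2 * r + 1"] half_angle_deficiency[OF k r c] k
    by simp
qed

theorem theorem3p12:
  fixes G :: "'a pair_pre_digraph" and k n :: nat
  assumes "k \<ge> 2"
    and "pair_graph G"
    and "Digraph_Component.connected (with_proj G)"
    and "card (pverts G) = n"
    and "real n \<ge> real (2 * k + 1) powi (20 + 23 * (int k - 1) * r_eps 0.0097 k)"
  shows "eigenvalue_sum k G \<ge> eigenvalue_sum k (path_graph n) \<and>
    (eigenvalue_sum k G = eigenvalue_sum k (path_graph n) \<longleftrightarrow> graph_iso G (path_graph n))"
proof -
  note G = assms(2) and k = assms(1) and card = assms(4)
  obtain r where r: "1 \<le> r" "r_eps 0.0097 k = int r"
    and c: "1 - 0.0097 / real (k - 1) \<le> cos (pi / (real r + 1))"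
    using r_eps_properties[OF k] by blast
  define E where "E = 20 + 23 * (k - 1) * r"
  have "20 + 23 * (int k - 1) * r_eps 0.0097 k = int E"
    using k r by (simp add: E_def of_nat_diff)
  then have "real ((2 * k + 1) ^ E) \<le> real n" using assms(5) by simp
  then have n: "(2 * k + 1) ^ E \<le> n" by (simp only: of_nat_le_iff)
  have iso_eq: "eigenvalue_sum k G = eigenvalue_sum k (path_graph n)" if "graph_iso G (path_graph n)"
    using graph_iso_realizes[OF G pair_graph_path_graph that realizes_path_graph] realizes_path_graph
    by (rule realizes_eigenvalue_sum_eq)
  have "(2 * k + 1) ^ 4 \<le> (2 * k + 1) ^ E" by (intro power_increasing) (auto simp: E_def)
  then have n4: "(2 * k + 1) ^ 4 \<le> n" using n by simp
  have "12 * k ^ 3 + 2 * (2 * k + 1)\<^sup>2 \<le> (2 * k + 1) ^ 4"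
  proof -
    have "12 * k ^ 3 \<le> 16 * k ^ 3" by simp
    moreover have "1 \<le> k" using k by simp
    moreover have "(2 * k + 1) ^ 4 = 16 * k ^ 4 + 32 * k ^ 3 + 24 * k\<^sup>2 + 8 * k + 1"
      by (simp add: power_numeral_even power3_eq_cube power2_eq_square algebra_simps)
    moreover have "2 * (2 * k + 1)\<^sup>2 = 8 * k\<^sup>2 + 8 * k + 2" by (simp add: power2_eq_square algebra_simps)
    moreover have "1 \<le> k\<^sup>2" using k by simp
    ultimately show ?thesis by linarith
  qed
  then have big: "12 * k ^ 3 + 2 * (2 * k + 1)\<^sup>2 \<le> n" using n4 by linarith
  moreover have "2 * (2 * k + 1)\<^sup>2 = 8 * k\<^sup>2 + 8 * k + 2" by (simp add: power2_eq_square algebra_simps)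
  \<comment> \<open>The three bounds serve the vertex of large degree, the cycle with m = n - 1, and
    the forks with m >= n - 3.\<close>
  ultimately have n_large: "4 * k\<^sup>2 + k \<le> n" "12 * k ^ 3 + 1 \<le> n" "4 * k + 3 \<le> n" using k by linarith+
  have path_less: "eigenvalue_sum k (path_graph n) < 2 * real k"
    using n_large(3) k by (intro eigenvalue_sum_path_graph_less) auto
  \<comment> \<open>This alternative yields both claims: an isomorphism forces equality by
    \<open>iso_eq\<close>, so a strict inequality excludes one.\<close>
  have "eigenvalue_sum k (path_graph n) < eigenvalue_sum k G \<or> graph_iso G (path_graph n)"
  proof (cases "2 * real k \<le> eigenvalue_sum k G")
    case True
    then show ?thesis using path_less by linarith
  next
    case small: False
    have deg1: "card {y. (x, y) \<in> parcs G} < 4 * k\<^sup>2" if "x \<in> pverts G" for x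
      using eigenvalue_sum_ge_large_degree[OF G that, of k] small n_large(1) card k by linarith
    have deg2: "card {y. (x, y) \<in> parcs G} \<le> 4" if x: "x \<in> pverts G" for x
    proof (rule ccontr)
      assume five: "\<not> card {y. (x, y) \<in> parcs G} \<le> 4"
      \<comment> \<open>The base of the ball bound is (2 k)^2, so a radius D costs an exponent 2 D.
        Twice (k + 5) * r still lies below \<open>E\<close>.\<close>
      have "(4 * k\<^sup>2 - 1 + 1) ^ ((k + 5) * r) = (2 * k) ^ (2 * ((k + 5) * r))"
        using k by (simp add: power_mult power_mult_distrib)
      also have "\<dots> \<le> (2 * k + 1) ^ (2 * ((k + 5) * r))" by (intro power_mono) auto
      also have "\<dots> < (2 * k + 1) ^ E"
      proof (rule power_strict_increasing)
        obtain j where "k = j + 2" using k by (metis add.commute le_Suc_ex)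
        then show "2 * ((k + 5) * r) < E" by (simp add: E_def algebra_simps)
      qed (use k in simp)
      finally have lt: "(4 * k\<^sup>2 - 1 + 1) ^ ((k + 5) * r) < card (pverts G)" using n card by simp
      have "card {y. (v, y) \<in> parcs G} \<le> 4 * k\<^sup>2 - 1" if "v \<in> pverts G" for v
        using deg1[OF that] by simp
      from long_graph_path[OF G assms(3) this lt]
      obtain p where "graph_path G p" "(k + 5) * r + 2 \<le> length p" by blast
      then have "2 * real k \<le> eigenvalue_sum k G"
        using five by (intro eigenvalue_sum_ge_degree_5[OF G x _ _ k r(1) _ c]) auto
      then show False using small by simp
    qed
    \<comment> \<open>The base is now 5 <= 2 k + 1, so the radius can be almost the full
      exponent.\<close>
    have "(4 + 1) ^ (E - 1) < (4 + 1 :: nat) ^ E" by (intro power_strict_increasing) (auto simp: E_def)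
    also have "\<dots> \<le> (2 * k + 1) ^ E" using k by (intro power_mono) auto
    finally have lt: "(4 + 1) ^ (E - 1) < card (pverts G)" using n card by simp
    from long_graph_path[OF G assms(3) deg2 lt]
    obtain q where q: "graph_path G q" "E - 1 + 2 \<le> length q" by blast
    obtain p where p: "longest_path G p" "length q \<le> length p" using longest_path_exists[OF G q(1)] by blast
    have gp: "graph_path G p" using p by (simp add: longest_path_def)
    have len: "E + 1 \<le> length p" using p(2) q(2) by simp
    \<comment> \<open>For k = 2 this reads 22 r + 11 <= 23 r + 21, the case in which the coefficient
      23 has the least room.\<close>
    have "(k + 9) * (2 * r + 1) \<le> E + 1"
    proof -
      obtain j where j: "k = j + 2" using k by (metis add.commute le_Suc_ex)
      have "j \<le> j * r" using r(1) by (cases r) auto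
      moreover have "(k + 9) * (2 * r + 1) = 2 * (j * r) + j + 22 * r + 11"
        by (simp add: j algebra_simps)
      moreover have "E + 1 = 23 * (j * r) + 23 * r + 21" by (simp add: E_def j algebra_simps)
      ultimately show ?thesis using r(1) by linarith
    qed
    then have "(k + 9) * (2 * r + 1) \<le> length p" using len by simp
    then have h: "\<not> heavy G"
      using eigenvalue_sum_ge_if_heavy[OF G _ gp k r(1) _ c] small by blast
    obtain m where m: "length p = Suc m" using len by (cases "length p") auto
    have m18: "18 \<le> m" using len m by (simp add: E_def)
    from classification[OF G assms(3) p(1) m m18 h] consider
      "realizes G (m + 1) path_rel" | "realizes G (m + 1) (cycle_rel m)"
      | "realizes G (m + 2) (fork_rel m)" | "realizes G (m + 3) (double_fork_rel m)" by blast
    then show ?thesis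
    proof cases
      case 1
      then have "realizes G n path_rel" using realizes_card[OF 1] card by simp
      moreover have "realizes (path_graph n) n path_rel"
        using realizes_path_graph[of n] by (simp add: path_rel_def[abs_def])
      ultimately show ?thesis using realizes_graph_iso[OF G pair_graph_path_graph] by blast
    next
      case 2
      then have "n = m + 1" using realizes_card card by metis
      then show ?thesis using eigenvalue_sum_cycle[OF G 2, of k] n_large k by simp
    next
      case 3
      then have "n = m + 2" using realizes_card card by metis
      then show ?thesis using eigenvalue_sum_fork[OF G 3, of k] n_large k m18 by simp
    next
      case 4
      then have "n = m + 3" using realizes_card card by metis
      then show ?thesis using eigenvalue_sum_double_fork[OF G 4, of k] n_large k m18 by simp
    qed
  qed
  then show ?thesis using iso_eq by auto
qed

end
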